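(* Let $\mathcal X,\mathcal S,\mathcal Y,\mathcal V$ be finite alphabets, $P_S$ a pmf on $\mathcal S$, and $W(y,v|x,s)$ an arbitrary joint transition law from $\mathcal X\times\mathcal S$ to $\mathcal Y\times\mathcal V$. For the memoryless symbol-unaware sensing ISAC model described in the context, the achievable communication--sensing region, and conversely the closure of all achievable pairs $(R,D)$, is $$\mathcal C=\bigcup_{P_QP_{X|Q}:\ |\mathcal Q|\le 2}\Big\{(R,D):\ 0\le R\le I(X;Y|Q),\ 0\le D\le I(S;V|Q)\Big\},$$ where $I(X;Y|Q)$ is computed with the communication marginal $W_c$ (i.e. under $P_Q(q)P_{X|Q}(x|q)W_c(y|x)$), and $I(S;V|Q)$ is computed with the sensing marginal $P_SW_s$ (i.e. under $P_Q(q)P_{X|Q}(x|q)P_S(s)W_s(v|x,s)$). Consequently, $\mathcal C$ depends on the physical joint channel $W(y,v|x,s)$ only through the two marginals $W_c(y|x)$ and $W_s(v|x,s)$. Equivalently, the dominant tradeoff boundary of $\mathcal C$ is the upper concave envelope of the single-mode frontier generated by input distributions $P_X$, and the full region $\mathcal C$ is the downward closure of this boundary. Hence, when the endpoint values are nonzero, the complete outer boundary also includes the horizontal and vertical endpoint extensions induced by this downward closure.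
   Context: Model. The states $S_1,S_2,\dots$ are i.i.d. $\sim P_S$ and independent of the message; for a length-$n$ input $x^n$, $$P(s^n,y^n,v^n|x^n)=\prod_{i=1}^nP_S(s_i)W(y_i,v_i|x_i,s_i).$$ $Y^n$ is observed by the communication receiver and $V^n$ is the sensing observation. The marginal laws are $W_c(y|x)=\sum_{s,v}P_S(s)W(y,v|x,s)$ and $W_s(v|x,s)=\sum_yW(y,v|x,s)$. $\mathcal P(\mathcal X)$ is the set of pmfs on $\mathcal X$. For $P_X\in\mathcal P(\mathcal X)$, $R(P_X)=I(X;Y)$ under $P_X(x)W_c(y|x)$, and $D(P_X)=I(S;V)$ under the joint law $P_{S,V}(s,v)=P_S(s)\sum_xP_X(x)W_s(v|x,s)$ (mutual information not conditioned on $X$). Logarithms are base 2. Codes. A $(2^{nR},n)$ code consists of the message set $\mathcal W=[1:2^{nR}]$, an encoder $f_n:\mathcal W\to\mathcal X^n$, and a decoder $\phi_n:\mathcal Y^n\to\mathcal W$. The message is uniform on $\mathcal W$, $X^n$ is the encoder output, $P_e^{(n)}$ is the average probability of decoding error, $P^{(n)}_{X_i}(x)=\Pr[X_i=x]$, and the sensing performance is $$D_n(f_n)=\frac1n\sum_{i=1}^nD\big(P^{(n)}_{X_i}\big).$$ A pair $(R,D)$ is achievable if there is a sequence of $(2^{nR},n)$ codes with $P_e^{(n)}\to0$ and $\liminf_{n\to\infty}D_n(f_n)\ge D$. Geometric terms. $Q$ is an auxiliary time-sharing variable with alphabet $\mathcal Q$. The single-mode operating points are the pairs in $\mathcal A=\{(R(P_X),D(P_X)):P_X\in\mathcal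 P(\mathcal X)\}$, i.e. those obtained without time sharing, and the single-mode frontier is the upper boundary of this set, viewed as a curve giving $R$ as a function of $D$. The upper concave envelope of a function is the smallest concave function dominating it. The dominant tradeoff boundary of $\mathcal C$ is its upper boundary, along which rate is traded against sensing. The downward closure of a set of pairs is the set of all $(R,D)$ with $0\le R\le R'$ and $0\le D\le D'$ for some $(R',D')$ in the set. The endpoint values are the coordinates of the two endpoints of the tradeoff boundary, and the endpoint extensions are the horizontal and vertical segments from these endpoints to the coordinate axes. *)

theory Defs
  imports "HOL-Probability.Probability" "HOL-Probability.Product_PMF"
begin

definition mutual_info :: "('a \<times> 'b) pmf \<Rightarrow> real" where
  "mutual_info p =
     prob_space.mutual_information (measure_pmf p) 2 (count_space UNIV) (count_space UNIV) fst snd"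

text \<open>Logarithms are to base 2.  For a joint law of triples $(q,a,b)$ this is $I(A;B|Q)$.\<close>

definition cond_mutual_info :: "('q \<times> 'a \<times> 'b) pmf \<Rightarrow> real" where
  "cond_mutual_info p =
     prob_space.conditional_mutual_information (measure_pmf p) 2
       (count_space UNIV) (count_space UNIV) (count_space UNIV)
       (\<lambda>(q, a, b). a) (\<lambda>(q, a, b). b) (\<lambda>(q, a, b). q)"

definition Wc :: "'s pmf \<Rightarrow> ('x \<Rightarrow> 's \<Rightarrow> ('y \<times> 'v) pmf) \<Rightarrow> 'x \<Rightarrow> 'y pmf" where
  "Wc PS W x = bind_pmf PS (\<lambda>s. map_pmf fst (W x s))"

definition Ws :: "('x \<Rightarrow> 's \<Rightarrow> ('y \<times> 'v) pmf) \<Rightarrow> 'x \<Rightarrow> 's \<Rightarrow> 'v pmf" where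
  "Ws W x s = map_pmf snd (W x s)"

definition rate :: "'s pmf \<Rightarrow> ('x \<Rightarrow> 's \<Rightarrow> ('y \<times> 'v) pmf) \<Rightarrow> 'x pmf \<Rightarrow> real" where
  "rate PS W PX =
     mutual_info (bind_pmf PX (\<lambda>x. map_pmf (\<lambda>y. (x, y)) (Wc PS W x)))"

definition sensing :: "'s pmf \<Rightarrow> ('x \<Rightarrow> 's \<Rightarrow> ('y \<times> 'v) pmf) \<Rightarrow> 'x pmf \<Rightarrow> real" where
  "sensing PS W PX =
     mutual_info (bind_pmf PS (\<lambda>s. bind_pmf PX (\<lambda>x. map_pmf (\<lambda>v. (s, v)) (Ws W x s))))"

text \<open>
  Words of length $n$ are the elements of \<open>{..<n} \<rightarrow>\<^sub>E UNIV\<close>.  The set $[1:2^{nR}]$ consists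
  of the integers between $1$ and $2^{nR}$.
\<close>

definition messages :: "real \<Rightarrow> nat \<Rightarrow> nat set" where
  "messages R n = {1..nat \<lfloor>2 powr (real n * R)\<rfloor>}"

definition is_code ::
  "real \<Rightarrow> nat \<Rightarrow> (nat \<Rightarrow> nat \<Rightarrow> 'x) \<Rightarrow> ((nat \<Rightarrow> 'y) \<Rightarrow> nat) \<Rightarrow> bool" where
  "is_code R n f \<phi> \<longleftrightarrow>
     f \<in> messages R n \<rightarrow> ({..<n} \<rightarrow>\<^sub>E UNIV) \<and> \<phi> \<in> ({..<n} \<rightarrow>\<^sub>E UNIV) \<rightarrow> messages R n"

text \<open>
  The law of $(s^n,y^n,v^n)$ given $x^n$ is the product over $i<n$ of the laws
  $P_S(s)W(y,v|x_i,s)$, written as a law of sequences of triples.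
\<close>

definition block_law ::
  "'s pmf \<Rightarrow> ('x \<Rightarrow> 's \<Rightarrow> ('y \<times> 'v) pmf) \<Rightarrow> nat \<Rightarrow> (nat \<Rightarrow> 'x) \<Rightarrow> (nat \<Rightarrow> 's \<times> 'y \<times> 'v) pmf" where
  "block_law PS W n x =
     Pi_pmf {..<n} undefined
       (\<lambda>i. bind_pmf PS (\<lambda>s. map_pmf (\<lambda>(y, v). (s, y, v)) (W (x i) s)))"

definition received :: "nat \<Rightarrow> (nat \<Rightarrow> 's \<times> 'y \<times> 'v) \<Rightarrow> (nat \<Rightarrow> 'y)" where
  "received n z = (\<lambda>i\<in>{..<n}. fst (snd (z i)))"

definition error_prob ::
  "'s pmf \<Rightarrow> ('x \<Rightarrow> 's \<Rightarrow> ('y \<times> 'v) pmf) \<Rightarrow> real \<Rightarrow> nat \<Rightarrow>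
     (nat \<Rightarrow> nat \<Rightarrow> 'x) \<Rightarrow> ((nat \<Rightarrow> 'y) \<Rightarrow> nat) \<Rightarrow> real" where
  "error_prob PS W R n f \<phi> =
     measure_pmf.prob
       (bind_pmf (pmf_of_set (messages R n))
          (\<lambda>w. map_pmf (\<lambda>z. (w, z)) (block_law PS W n (f w))))
       {(w, z). \<phi> (received n z) \<noteq> w}"

definition input_marginal :: "real \<Rightarrow> nat \<Rightarrow> (nat \<Rightarrow> nat \<Rightarrow> 'x) \<Rightarrow> nat \<Rightarrow> 'x pmf" where
  "input_marginal R n f i = map_pmf (\<lambda>w. f w i) (pmf_of_set (messages R n))"

definition code_sensing ::
  "'s pmf \<Rightarrow> ('x \<Rightarrow> 's \<Rightarrow> ('y \<times> 'v) pmf) \<Rightarrow> real \<Rightarrow> nat \<Rightarrow> (nat \<Rightarrow> nat \<Rightarrow> 'x) \<Rightarrow> real" where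
  "code_sensing PS W R n f = 1 / real n * (\<Sum>i<n. sensing PS W (input_marginal R n f i))"

text \<open>
  Rates and sensing levels are nonnegative; without this restriction every negative sensing
  level would be achievable.
\<close>

definition achievable_pairs ::
  "'s pmf \<Rightarrow> ('x \<Rightarrow> 's \<Rightarrow> ('y \<times> 'v) pmf) \<Rightarrow> (real \<times> real) set" where
  "achievable_pairs PS W =
     {(R, D). 0 \<le> R \<and> 0 \<le> D \<and>
        (\<exists>f \<phi>. (\<forall>n. is_code R n (f n) (\<phi> n)) \<and>
           (\<lambda>n. error_prob PS W R n (f n) (\<phi> n)) \<longlonglongrightarrow> 0 \<and>
           ereal D \<le> liminf (\<lambda>n. ereal (code_sensing PS W R n (f n))))}"

definition cond_rate ::
  "'s pmf \<Rightarrow> ('x \<Rightarrow> 's \<Rightarrow> ('y \<times> 'v) pmf) \<Rightarrow> 'q pmf \<Rightarrow> ('q \<Rightarrow> 'x pmf) \<Rightarrow> real" where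
  "cond_rate PS W PQ PXQ =
     cond_mutual_info (bind_pmf PQ (\<lambda>q. bind_pmf (PXQ q) (\<lambda>x.
       map_pmf (\<lambda>y. (q, x, y)) (Wc PS W x))))"

definition cond_sensing ::
  "'s pmf \<Rightarrow> ('x \<Rightarrow> 's \<Rightarrow> ('y \<times> 'v) pmf) \<Rightarrow> 'q pmf \<Rightarrow> ('q \<Rightarrow> 'x pmf) \<Rightarrow> real" where
  "cond_sensing PS W PQ PXQ =
     cond_mutual_info (bind_pmf PQ (\<lambda>q. bind_pmf (PXQ q) (\<lambda>x. bind_pmf PS (\<lambda>s.
       map_pmf (\<lambda>v. (q, s, v)) (Ws W x s)))))"

text \<open>Auxiliary alphabets are taken, up to renaming, to be finite sets of natural numbers.\<close>

definition region :: "'s pmf \<Rightarrow> ('x \<Rightarrow> 's \<Rightarrow> ('y \<times> 'v) pmf) \<Rightarrow> (real \<times> real) set" where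
  "region PS W =
     \<Union> {{0..cond_rate PS W PQ PXQ} \<times> {0..cond_sensing PS W PQ PXQ} | Q PQ (PXQ :: nat \<Rightarrow> 'x pmf).
          finite Q \<and> card Q \<le> 2 \<and> set_pmf PQ \<subseteq> Q}"

definition single_mode_points ::
  "'s pmf \<Rightarrow> ('x \<Rightarrow> 's \<Rightarrow> ('y \<times> 'v) pmf) \<Rightarrow> (real \<times> real) set" where
  "single_mode_points PS W = range (\<lambda>PX. (rate PS W PX, sensing PS W PX))"

text \<open>The upper boundary of a set of pairs $(R,D)$, giving $R$ as a function of $D$ on the projection
  \<open>snd ` A\<close>.\<close>

definition upper_boundary :: "(real \<times> real) set \<Rightarrow> real \<Rightarrow> real" where
  "upper_boundary A d = Sup {r. (r, d) \<in> A}"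

definition is_upper_concave_envelope :: "real set \<Rightarrow> (real \<Rightarrow> real) \<Rightarrow> (real \<Rightarrow> real) \<Rightarrow> bool" where
  "is_upper_concave_envelope I r g \<longleftrightarrow>
     concave_on I g \<and> (\<forall>d\<in>I. r d \<le> g d) \<and>
     (\<forall>h. concave_on I h \<and> (\<forall>d\<in>I. r d \<le> h d) \<longrightarrow> (\<forall>d\<in>I. g d \<le> h d))"

text \<open>
  The part of the upper boundary along which neither coordinate can be increased without
  decreasing the other one.
\<close>

definition tradeoff_boundary :: "(real \<times> real) set \<Rightarrow> (real \<times> real) set" where
  "tradeoff_boundary C =
     {(R, D) \<in> C. \<forall>(R', D') \<in> C. R \<le> R' \<and> D \<le> D' \<longrightarrow> R' = R \<and> D' = D}"

definition rate_endpoint :: "(real \<times> real) set \<Rightarrow> real \<times> real" where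
  "rate_endpoint T = (Sup (fst ` T), Inf (snd ` T))"

definition sensing_endpoint :: "(real \<times> real) set \<Rightarrow> real \<times> real" where
  "sensing_endpoint T = (Inf (fst ` T), Sup (snd ` T))"

definition downward_closure :: "(real \<times> real) set \<Rightarrow> (real \<times> real) set" where
  "downward_closure T = {(R, D). \<exists>(R', D') \<in> T. 0 \<le> R \<and> R \<le> R' \<and> 0 \<le> D \<and> D \<le> D'}"

definition rate_extension :: "(real \<times> real) set \<Rightarrow> (real \<times> real) set" where
  "rate_extension T = closed_segment (rate_endpoint T) (fst (rate_endpoint T), 0)"

definition sensing_extension :: "(real \<times> real) set \<Rightarrow> (real \<times> real) set" where
  "sensing_extension T = closed_segment (sensing_endpoint T) (0, snd (sensing_endpoint T))"

text \<open>
  The frontier relative to the nonnegative quadrant, so that the sides of the region lying on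
  the coordinate axes are not counted.
\<close>

definition outer_boundary :: "(real \<times> real) set \<Rightarrow> (real \<times> real) set" where
  "outer_boundary C = (top_of_set ({0..} \<times> {0..})) frontier_of C"

end

theory Submission
  imports Defs
begin

text \<open>
  Write $R(P)$ and $D(P)$ for the rate and the sensing level of an input law $P$.  Both are mutual
  informations across a channel, hence nonnegative and continuous on the simplex of input laws, and
  $D$ is convex.  Let $H$ be the convex hull of the compact set of all $(R(P), D(P))$; since a point of
  a triangle is dominated by a point of one of its sides, the region is the downward closure of $H$.

  Converse: the positions of a code give the point $\frac1n \sum_i (R(P_{X_i}), D(P_{X_i}))$ of $H$,
  and $n^{-1} \sum_i R(P_{X_i})$ is, up to vanishing terms, at least the code rate.  Achievability: choose the
  codewords at random with independent letters, a fraction $u$ of them from $P_0$ and the rest from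
  $P_1$, and decode by thresholding the likelihood ratio.  The expected error vanishes by Hoeffding's
  inequality, and the expected sensing level is at least $u D(P_0) + (1 - u) D(P_1)$ by convexity.

  The boundary statements hold for the downward closure of the convex hull of any
  compact planar set in the nonnegative quadrant whose second projection is an interval.
\<close>

section \<open>Mutual information as a finite sum\<close>

text \<open>Time sharing is tied to letter positions. The sensing level of a code averages D over
  positions, so a random code using the mixed law at every position would be guaranteed only D of
  the mixture, which by convexity is at most the mixture of the two D values. In the converse the
  position itself plays the auxiliary variable: the average of the n mode points is a convex
  combination and so lies in H. Caratheodory's theorem in the plane would give three modes; asking
  for domination in place of equality saves one, and this is the bound on the auxiliary alphabet.

  The random coding argument spends a positive gap between the rate and the information bound on its
  error exponent. Points with the extremal rate are therefore reached as limits, which is why the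
  operational set meets the region through its closure. Rate zero gets codes of its own, since no
  smaller nonnegative rate is available there to approximate from below.\<close>

definition chan_info :: "'a::finite pmf \<Rightarrow> ('a \<Rightarrow> 'b::finite pmf) \<Rightarrow> real" where
  "chan_info P K = (\<Sum>a\<in>UNIV. \<Sum>b\<in>UNIV. pmf P a * pmf (K a) b *
     log 2 (pmf (K a) b / pmf (bind_pmf P K) b))"

lemma distributed_pmf:
  "distributed (measure_pmf p) (count_space UNIV) Z (pmf (map_pmf Z p))"
  unfolding distributed_def by (simp add: map_pmf_rep_eq[symmetric] flip: measure_pmf_eq_density)

text \<open>Countability makes the product of two counting measures a counting measure, so the joint
  pmf is a density for it. Keeping the expectation on the underlying space lets two mutual
  informations of the same law be subtracted under one expectation.\<close>

lemma mutual_information_pmf: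
  fixes X :: "'w \<Rightarrow> 'a::countable" and Y :: "'w \<Rightarrow> 'b::countable"
  shows "prob_space.mutual_information (measure_pmf p) (2::real) (count_space UNIV) (count_space UNIV) X Y =
    measure_pmf.expectation p (\<lambda>w. log 2 (pmf (map_pmf (\<lambda>w. (X w, Y w)) p) (X w, Y w) /
       (pmf (map_pmf X p) (X w) * pmf (map_pmf Y p) (Y w))))"
proof -
  interpret information_space "measure_pmf p" "2::real" by unfold_locales simp
  let ?J = "map_pmf (\<lambda>w. (X w, Y w)) p"
  have cs: "count_space UNIV \<Otimes>\<^sub>M count_space UNIV = (count_space UNIV :: ('a \<times> 'b) measure)"
    by (simp add: pair_measure_countable)
  have "prob_space.mutual_information (measure_pmf p) (2::real) (count_space UNIV) (count_space UNIV) X Y =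
    integral\<^sup>L (count_space UNIV \<Otimes>\<^sub>M count_space UNIV)
     (\<lambda>x. pmf ?J x * log 2 (pmf ?J x / (pmf (map_pmf X p) (fst x) * pmf (map_pmf Y p) (snd x))))"
    using mutual_information_distr[of "count_space UNIV" "count_space UNIV" X "pmf (map_pmf X p)"
         Y "pmf (map_pmf Y p)" "pmf ?J"]
    by (simp add: cs distributed_pmf sigma_finite_measure_count_space)
  also have "\<dots> = measure_pmf.expectation ?J (\<lambda>x. log 2 (pmf ?J x /
      (pmf (map_pmf X p) (fst x) * pmf (map_pmf Y p) (snd x))))"
    unfolding cs measure_pmf_eq_density[of ?J] by (subst integral_density) auto
  also have "\<dots> = measure_pmf.expectation p (\<lambda>w. log 2 (pmf ?J (X w, Y w) /
       (pmf (map_pmf X p) (X w) * pmf (map_pmf Y p) (Y w))))"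
    by simp
  finally show ?thesis .
qed

lemma pmf_bind_Pair:
  "pmf (bind_pmf P (\<lambda>a. map_pmf (Pair a) (K a))) (a, b) = pmf P a * pmf (K a) b"
proof -
  have "pmf (bind_pmf P (\<lambda>a. map_pmf (Pair a) (K a))) (a, b) =
      measure_pmf.expectation P (\<lambda>x. indicator {a} x * pmf (K a) b)"
    unfolding pmf_bind
    by (intro Bochner_Integration.integral_cong refl)
       (auto simp: indicator_def pmf_map vimage_def measure_pmf_single)
  then show ?thesis by (simp add: measure_pmf_single)
qed

text \<open>The input weight cancels inside the logarithm, and where it is zero the factor in front
  removes the term. The same factor makes the values chosen for \<open>log 2 0\<close> and for
  division by zero harmless in \<open>chan_info\<close>.\<close>

lemma mutual_info_bind:
  fixes P :: "'a::finite pmf" and K :: "'a \<Rightarrow> 'b::finite pmf"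
  shows "mutual_info (bind_pmf P (\<lambda>a. map_pmf (\<lambda>b. (a, b)) (K a))) = chan_info P K"
proof -
  let ?p = "bind_pmf P (\<lambda>a. map_pmf (\<lambda>b. (a, b)) (K a))"
  have J: "pmf ?p (a, b) = pmf P a * pmf (K a) b" for a b
    by (rule pmf_bind_Pair)
  have m1: "map_pmf fst ?p = P" by (simp add: map_bind_pmf pmf.map_comp o_def bind_return_pmf')
  have m2: "map_pmf snd ?p = bind_pmf P K" by (simp add: map_bind_pmf pmf.map_comp o_def)
  have "mutual_info ?p = measure_pmf.expectation ?p (\<lambda>w. log 2 (pmf ?p w / (pmf P (fst w) * pmf (bind_pmf P K) (snd w))))"
    unfolding mutual_info_def mutual_information_pmf by (simp add: m1 m2)
  also have "\<dots> = (\<Sum>w\<in>UNIV. pmf ?p w * log 2 (pmf ?p w / (pmf P (fst w) * pmf (bind_pmf P K) (snd w))))"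
    by (subst integral_measure_pmf[of UNIV]) auto
  also have "\<dots> = (\<Sum>a\<in>UNIV. \<Sum>b\<in>UNIV. pmf P a * pmf (K a) b * log 2 (pmf P a * pmf (K a) b / (pmf P a * pmf (bind_pmf P K) b)))"
    unfolding sum.cartesian_product UNIV_Times_UNIV
    by (intro sum.cong refl) (auto simp: J)
  also have "\<dots> = chan_info P K"
    unfolding chan_info_def
    by (intro sum.cong refl) auto
  finally show ?thesis .
qed

lemma rate_eq: "rate PS W P = chan_info P (Wc PS W)"
  unfolding rate_def mutual_info_bind ..

text \<open>For sensing the state is the channel input, and the transmitted letter is noise averaged
  into the channel. The input law thus enters through the channel argument, in which mutual
  information is convex.\<close>

lemma sensing_eq: "sensing PS W P = chan_info PS (\<lambda>s. bind_pmf P (\<lambda>x. Ws W x s))"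
  unfolding sensing_def mutual_info_bind[symmetric] by (simp add: map_bind_pmf)

text \<open>Conditional information unfolds to I(A;(B,Q)) - I(A;Q). Under a common expectation the
  two log ratios combine to the log ratio of the channel at q, and averaging over q remains.\<close>

lemma cond_mutual_info_bind:
  fixes PQ :: "'q::countable pmf" and P :: "'q \<Rightarrow> 'a::finite pmf"
    and K :: "'q \<Rightarrow> 'a \<Rightarrow> 'b::finite pmf"
  assumes "finite Q" "set_pmf PQ \<subseteq> Q"
  shows "cond_mutual_info (bind_pmf PQ (\<lambda>q. bind_pmf (P q) (\<lambda>a. map_pmf (\<lambda>b. (q, a, b)) (K q a)))) =
    (\<Sum>q\<in>Q. pmf PQ q * chan_info (P q) (K q))"
proof -
  define J where "J q = bind_pmf (P q) (\<lambda>a. map_pmf (Pair a) (K q a))" for q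
  define p where "p = bind_pmf PQ (\<lambda>q. map_pmf (Pair q) (J q))"
  have "finite (set_pmf PQ)" using assms finite_subset by auto
  then have fin: "finite (set_pmf p)" by (auto simp: p_def)
  have p_eq: "bind_pmf PQ (\<lambda>q. bind_pmf (P q) (\<lambda>a. map_pmf (\<lambda>b. (q, a, b)) (K q a))) = p"
    unfolding p_def J_def by (simp add: map_bind_pmf pmf.map_comp o_def)
  have cs: "count_space UNIV \<Otimes>\<^sub>M count_space UNIV = (count_space UNIV :: ('b \<times> 'q) measure)"
    by (simp add: pair_measure_countable)
  let ?A = "\<lambda>(q, a, b). a" and ?B = "\<lambda>(q, a, b). b" and ?Q = "\<lambda>(q::'q, a::'a, b::'b). q"
  let ?BQ = "\<lambda>(q::'q, a::'a, b::'b). (b, q)" and ?AQ = "\<lambda>(q::'q, a::'a, b::'b). (a, q)"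
  let ?ABQ = "\<lambda>(q::'q, a::'a, b::'b). (a, b, q)"
  have swap: "pmf (map_pmf (\<lambda>(x, y). (y, x)) r) (v, u) = pmf r (u, v)"
    for r :: "('c \<times> 'd) pmf" and u v
    using pmf_map_inj'[of "\<lambda>(x, y). (y, x)" r "(u, v)"] by (simp add: inj_on_def)
  have pQ: "map_pmf ?Q p = PQ" unfolding p_def
    by (simp add: map_bind_pmf pmf.map_comp o_def case_prod_unfold bind_return_pmf')
  have pBQ: "pmf (map_pmf ?BQ p) (b, q) = pmf PQ q * pmf (bind_pmf (P q) (K q)) b" for b q
  proof -
    have "map_pmf ?BQ p = map_pmf (\<lambda>(x, y). (y, x)) (bind_pmf PQ (\<lambda>q. map_pmf (Pair q) (bind_pmf (P q) (K q))))"
      unfolding p_def J_def by (simp add: map_bind_pmf pmf.map_comp o_def case_prod_unfold)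
    then show ?thesis by (simp add: swap pmf_bind_Pair)
  qed
  have pAQ: "pmf (map_pmf ?AQ p) (a, q) = pmf PQ q * pmf (P q) a" for a q
  proof -
    have "map_pmf ?AQ p = map_pmf (\<lambda>(x, y). (y, x)) (bind_pmf PQ (\<lambda>q. map_pmf (Pair q) (P q)))"
      unfolding p_def J_def by (simp add: map_bind_pmf pmf.map_comp o_def case_prod_unfold map_pmf_def[symmetric])
    then show ?thesis by (simp add: swap pmf_bind_Pair)
  qed
  have pABQ: "pmf (map_pmf ?ABQ p) (a, b, q) = pmf PQ q * (pmf (P q) a * pmf (K q a) b)" for a b q
  proof -
    have "pmf (map_pmf ?ABQ p) (?ABQ (q, a, b)) = pmf p (q, a, b)"
      by (rule pmf_map_inj') (auto simp: inj_on_def)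
    then show ?thesis by (simp add: p_def J_def pmf_bind_Pair)
  qed
  let ?f = "\<lambda>w. log 2 (pmf (map_pmf ?ABQ p) (?ABQ w) / (pmf (map_pmf ?A p) (?A w) * pmf (map_pmf ?BQ p) (?BQ w)))"
  let ?g = "\<lambda>w. log 2 (pmf (map_pmf ?AQ p) (?AQ w) / (pmf (map_pmf ?A p) (?A w) * pmf (map_pmf ?Q p) (?Q w)))"
  let ?h = "\<lambda>(q, a, b). log 2 (pmf (K q a) b / pmf (bind_pmf (P q) (K q)) b)"
  have int: "integrable (measure_pmf p) F" for F :: "_ \<Rightarrow> real"
    by (rule integrable_measure_pmf_finite[OF fin])
  have "cond_mutual_info p = measure_pmf.expectation p ?f - measure_pmf.expectation p ?g"
    unfolding cond_mutual_info_def prob_space.conditional_mutual_information_def[OF prob_space_measure_pmf] cs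
      mutual_information_pmf by (simp add: case_prod_unfold)
  also have "\<dots> = measure_pmf.expectation p (\<lambda>w. ?f w - ?g w)"
    by (rule Bochner_Integration.integral_diff[symmetric, OF int int])
  also have "\<dots> = measure_pmf.expectation p ?h"
  proof (intro integral_cong_AE AE_pmfI)
    fix w assume w: "w \<in> set_pmf p"
    obtain q a b where [simp]: "w = (q, a, b)" by (cases w)
    have "?A w \<in> set_pmf (map_pmf ?A p)" "?BQ w \<in> set_pmf (map_pmf ?BQ p)" "?AQ w \<in> set_pmf (map_pmf ?AQ p)"
        "?ABQ w \<in> set_pmf (map_pmf ?ABQ p)" using w unfolding set_map_pmf by (rule imageI)+
    then have pos: "pmf (map_pmf ?A p) a > 0" "pmf (map_pmf ?BQ p) (b, q) > 0" "pmf (map_pmf ?AQ p) (a, q) > 0"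
        "pmf (map_pmf ?ABQ p) (a, b, q) > 0"
      by (simp_all add: pmf_positive)
    \<comment> \<open>The marginal of the first component occurs in both quotients and cancels in
      the difference; only its positivity matters, so it is kept opaque.\<close>
    define A where "A = pmf (map_pmf ?A p) a"
    have A: "A > 0" using pos by (simp add: A_def)
    have pos': "pmf PQ q > 0" "pmf (P q) a > 0" "pmf (K q a) b > 0" "pmf (bind_pmf (P q) (K q)) b > 0"
      using pos unfolding pBQ pAQ pABQ zero_less_mult_iff by (auto simp: not_less[symmetric])
    show "?f w - ?g w = ?h w"
      using pos' A by (simp add: pBQ pAQ pABQ pQ A_def[symmetric] log_divide log_mult)
  qed auto
  also have "\<dots> = (\<Sum>q\<in>Q. pmf PQ q * measure_pmf.expectation (J q) (\<lambda>w. ?h (q, w)))"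
    unfolding p_def using assms by (subst pmf_expectation_bind) auto
  also have "\<dots> = (\<Sum>q\<in>Q. pmf PQ q * chan_info (P q) (K q))"
  proof (intro sum.cong refl arg_cong2[of _ _ _ _ "(*)"])
    fix q
    have "measure_pmf.expectation (J q) (\<lambda>w. ?h (q, w)) =
      (\<Sum>a\<in>UNIV. pmf (P q) a * measure_pmf.expectation (K q a) (\<lambda>b. ?h (q, a, b)))"
      unfolding J_def by (subst pmf_expectation_bind[of UNIV]) auto
    also have "\<dots> = chan_info (P q) (K q)"
      unfolding chan_info_def
      by (subst integral_measure_pmf[of UNIV]) (auto simp: sum_distrib_left mult.assoc)
    finally show "measure_pmf.expectation (J q) (\<lambda>w. ?h (q, w)) = chan_info (P q) (K q)" .
  qed
  finally show ?thesis unfolding p_eq .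
qed

lemma cond_rate_eq:
  fixes PQ :: "nat pmf" and PS :: "'s::finite pmf" and W :: "'x::finite \<Rightarrow> 's \<Rightarrow> ('y::finite \<times> 'v::finite) pmf"
  assumes "finite Q" "set_pmf PQ \<subseteq> Q"
  shows "cond_rate PS W PQ PXQ = (\<Sum>q\<in>Q. pmf PQ q * rate PS W (PXQ q))"
  unfolding cond_rate_def rate_eq cond_mutual_info_bind[OF assms] ..

lemma cond_sensing_eq:
  fixes PQ :: "nat pmf" and PS :: "'s::finite pmf" and W :: "'x::finite \<Rightarrow> 's \<Rightarrow> ('y::finite \<times> 'v::finite) pmf"
  assumes "finite Q" "set_pmf PQ \<subseteq> Q"
  shows "cond_sensing PS W PQ PXQ = (\<Sum>q\<in>Q. pmf PQ q * sensing PS W (PXQ q))"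
proof -
  \<comment> \<open>Given q, letter and state are independent and may be drawn in either order;
    drawing the state first absorbs the letter into the channel.\<close>
  have "bind_pmf PQ (\<lambda>q. bind_pmf (PXQ q) (\<lambda>x. bind_pmf PS (\<lambda>s. map_pmf (\<lambda>v. (q, s, v)) (Ws W x s)))) =
     bind_pmf PQ (\<lambda>q. bind_pmf PS (\<lambda>s. map_pmf (\<lambda>v. (q, s, v)) (bind_pmf (PXQ q) (\<lambda>x. Ws W x s))))"
    unfolding map_bind_pmf by (subst bind_commute_pmf) simp
  then show ?thesis
    unfolding cond_sensing_def sensing_eq using cond_mutual_info_bind[OF assms] by simp
qed

section \<open>Convexity and continuity\<close>

definition xlog2 :: "real \<Rightarrow> real" where
  "xlog2 t = t * log 2 t"

text \<open>The delicate point is 0, where t log t tends to 0 and so agrees with the value produced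
  by the factor t. Laws on the boundary of the simplex have zero entries, so this point cannot be
  avoided.\<close>

lemma continuous_on_xlog2: "continuous_on {0..} xlog2"
proof -
  have "continuous (at t within {0..}) xlog2" if "t \<ge> 0" for t
  proof (cases "t = 0")
    case True
    have "((\<lambda>t::real. t * ln t) \<longlongrightarrow> 0) (at_right 0)" by real_asymp
    then have "((\<lambda>t::real. t * ln t / ln 2) \<longlongrightarrow> 0 / ln 2) (at_right 0)" by (intro tendsto_divide) auto
    then have "(xlog2 \<longlongrightarrow> 0) (at_right 0)" by (simp add: xlog2_def[abs_def] log_def)
    then have "(xlog2 \<longlongrightarrow> xlog2 0) (at 0 within {0..})"
      by (simp add: xlog2_def[of 0] at_within_Ici_at_right)
    then show ?thesis using True by (simp add: continuous_within)
  next
    case False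
    then have "isCont xlog2 t" unfolding xlog2_def[abs_def] using that by (intro continuous_intros) auto
    then show ?thesis by (rule continuous_at_imp_continuous_at_within)
  qed
  then show ?thesis by (simp add: continuous_on_eq_continuous_within)
qed

lemma pmf_bind_sum: "pmf (bind_pmf P K) b = (\<Sum>a\<in>UNIV. pmf P a * pmf (K a) b)" for P :: "'a::finite pmf"
  unfolding pmf_bind by (subst integral_measure_pmf[of UNIV]) auto

lemma sum_pmf_UNIV [simp]: "(\<Sum>a\<in>UNIV. pmf P a) = 1" for P :: "'a::finite pmf"
  by (rule sum_pmf_eq_1) auto

lemma pmf_bind_pos:
  assumes "pmf P a > 0" "pmf (K a) b > 0"
  shows "pmf (bind_pmf P K) b > 0"
  using assms by (auto simp: pmf_positive_iff set_bind_pmf)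

text \<open>This is H(B) - H(B|A) with the signs absorbed into \<open>xlog2\<close>. The form
  contains no quotient, so its continuity in the input law and in the channel can be read
  off.\<close>

lemma chan_info_entropies:
  "chan_info P K = (\<Sum>a\<in>UNIV. pmf P a * (\<Sum>b\<in>UNIV. xlog2 (pmf (K a) b))) -
     (\<Sum>b\<in>UNIV. xlog2 (pmf (bind_pmf P K) b))"
proof -
  have "chan_info P K = (\<Sum>a\<in>UNIV. \<Sum>b\<in>UNIV. pmf P a * xlog2 (pmf (K a) b) -
      pmf P a * pmf (K a) b * log 2 (pmf (bind_pmf P K) b))"
    unfolding chan_info_def
  proof (intro sum.cong refl)
    fix a b
    show "pmf P a * pmf (K a) b * log 2 (pmf (K a) b / pmf (bind_pmf P K) b) =
      pmf P a * xlog2 (pmf (K a) b) - pmf P a * pmf (K a) b * log 2 (pmf (bind_pmf P K) b)"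
    proof (cases "pmf P a = 0 \<or> pmf (K a) b = 0")
      case False
      then have "pmf P a > 0" "pmf (K a) b > 0" by (auto simp: order_less_le)
      then show ?thesis using pmf_bind_pos[of P a K b]
        by (simp add: log_divide xlog2_def algebra_simps)
    qed (auto simp: xlog2_def)
  qed
  also have "\<dots> = (\<Sum>a\<in>UNIV. pmf P a * (\<Sum>b\<in>UNIV. xlog2 (pmf (K a) b))) -
     (\<Sum>b\<in>UNIV. \<Sum>a\<in>UNIV. pmf P a * pmf (K a) b * log 2 (pmf (bind_pmf P K) b))"
    unfolding sum_subtractf sum_distrib_left by (subst (3) sum.swap) (rule refl)
  also have "(\<Sum>b\<in>UNIV. \<Sum>a\<in>UNIV. pmf P a * pmf (K a) b * log 2 (pmf (bind_pmf P K) b)) =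
     (\<Sum>b\<in>UNIV. xlog2 (pmf (bind_pmf P K) b))"
    by (simp add: xlog2_def sum_distrib_right[symmetric] pmf_bind_sum)
  finally show ?thesis .
qed

lemma log2_le: "t > 0 \<Longrightarrow> log 2 t \<le> (t - 1) / ln 2"
  by (simp add: log_def ln_le_minus_one divide_right_mono)

text \<open>The posterior of any reference law gives a lower bound on the mutual information that is
  linear in the law and tight at the reference; this is the tangent-plane form of convexity.\<close>

lemma chan_info_tangent:
  fixes P :: "'a::finite pmf" and K K' :: "'a \<Rightarrow> 'b::finite pmf"
  assumes ac: "\<And>a b. pmf P a \<noteq> 0 \<Longrightarrow> pmf (K' a) b = 0 \<Longrightarrow> pmf (K a) b = 0"
  shows "(\<Sum>a\<in>UNIV. \<Sum>b\<in>UNIV. pmf P a * pmf (K a) b * log 2 (pmf (K' a) b / pmf (bind_pmf P K') b)) \<le> chan_info P K"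
proof -
  define q q' where "q = bind_pmf P K" and "q' = bind_pmf P K'"
  let ?L = "\<lambda>a b. pmf P a * pmf (K a) b * log 2 (pmf (K' a) b / pmf q' b)"
  let ?I = "\<lambda>a b. pmf P a * pmf (K a) b * log 2 (pmf (K a) b / pmf q b)"
  \<comment> \<open>Both logarithms are merged and ln t \<le> t - 1 is applied; after summation the
    right-hand side is a difference of total masses and is at most zero.\<close>
  have le: "?L a b - ?I a b \<le> (pmf P a * pmf (K' a) b * (pmf q b / pmf q' b) - pmf P a * pmf (K a) b) / ln 2" for a b
  proof (cases "pmf P a = 0 \<or> pmf (K a) b = 0")
    case True
    then show ?thesis by (auto intro!: divide_nonneg_nonneg mult_nonneg_nonneg)
  next
    case False
    then have pos: "pmf P a > 0" "pmf (K a) b > 0" "pmf (K' a) b > 0" using ac[of a b] by (auto simp: order_less_le)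
    then have qpos: "pmf q b > 0" "pmf q' b > 0" unfolding q_def q'_def by (auto intro: pmf_bind_pos)
    have "?L a b - ?I a b = pmf P a * pmf (K a) b * log 2 (pmf (K' a) b * pmf q b / (pmf q' b * pmf (K a) b))"
      using pos qpos by (simp add: log_divide log_mult algebra_simps)
    also have "\<dots> \<le> pmf P a * pmf (K a) b * ((pmf (K' a) b * pmf q b / (pmf q' b * pmf (K a) b) - 1) / ln 2)"
      using pos qpos by (intro mult_left_mono log2_le) auto
    also have "\<dots> = (pmf P a * pmf (K' a) b * (pmf q b / pmf q' b) - pmf P a * pmf (K a) b) / ln 2"
      using pos qpos by (simp add: field_simps)
    finally show ?thesis .
  qed
  have "(\<Sum>a\<in>UNIV. \<Sum>b\<in>UNIV. ?L a b) - chan_info P K = (\<Sum>a\<in>UNIV. \<Sum>b\<in>UNIV. ?L a b - ?I a b)"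
    by (simp add: chan_info_def sum_subtractf q_def)
  also have "\<dots> \<le> (\<Sum>a\<in>UNIV. \<Sum>b\<in>UNIV. (pmf P a * pmf (K' a) b * (pmf q b / pmf q' b) - pmf P a * pmf (K a) b) / ln 2)"
    by (intro sum_mono le)
  also have "\<dots> = ((\<Sum>a\<in>UNIV. \<Sum>b\<in>UNIV. pmf P a * pmf (K' a) b * (pmf q b / pmf q' b)) -
      (\<Sum>a\<in>UNIV. pmf P a * (\<Sum>b\<in>UNIV. pmf (K a) b))) / ln 2"
    by (simp only: sum_subtractf sum_divide_distrib[symmetric] sum_distrib_left)
  also have "(\<Sum>a\<in>UNIV. \<Sum>b\<in>UNIV. pmf P a * pmf (K' a) b * (pmf q b / pmf q' b)) =
      (\<Sum>b\<in>UNIV. pmf q' b * (pmf q b / pmf q' b))"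
    by (subst sum.swap) (simp add: sum_distrib_right[symmetric] sum_divide_distrib[symmetric] q'_def pmf_bind_sum)
  \<comment> \<open>Only an inequality: where \<open>pmf q' b\<close> is zero, the quotient is zero
    and the mass of q at b is lost.\<close>
  also have "\<dots> \<le> (\<Sum>b\<in>UNIV. pmf q b)" by (intro sum_mono) auto
  finally show ?thesis by (simp add: divide_right_mono q'_def)
qed

text \<open>The tangent bound is taken at the channel that ignores its input and emits the output
  law of K. Its log ratios vanish, so the bound reads 0.\<close>

lemma chan_info_nonneg:
  fixes P :: "'a::finite pmf" and K :: "'a \<Rightarrow> 'b::finite pmf"
  shows "chan_info P K \<ge> 0"
proof -
  let ?q = "bind_pmf P K"
  have "(\<Sum>a\<in>UNIV. \<Sum>b\<in>UNIV. pmf P a * pmf (K a) b *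
      log 2 (pmf ?q b / pmf (bind_pmf P (\<lambda>_. ?q)) b)) \<le> chan_info P K"
  proof (rule chan_info_tangent)
    fix a b assume "pmf P a \<noteq> 0" "pmf ?q b = 0"
    then show "pmf (K a) b = 0" using pmf_bind_pos[of P a K b] by (auto simp: order_less_le)
  qed
  moreover have "pmf P a * pmf (K a) b * log 2 (pmf ?q b / pmf (bind_pmf P (\<lambda>_. ?q)) b) = 0" for a b
    using pmf_bind_pos[of P a K b] by (cases "pmf ?q b = 0") (auto simp: order_less_le)
  then have "(\<Sum>a\<in>UNIV. \<Sum>b\<in>UNIV. pmf P a * pmf (K a) b *
      log 2 (pmf ?q b / pmf (bind_pmf P (\<lambda>_. ?q)) b)) = 0" by (intro sum.neutral ballI)
  ultimately show ?thesis by linarith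
qed

text \<open>The empirical marginals of a random codebook fluctuate around the design law; by convexity
  these fluctuations can only help sensing.\<close>

lemma sensing_convex:
  fixes PS :: "'s::finite pmf" and W :: "'x::finite \<Rightarrow> 's \<Rightarrow> ('y::finite \<times> 'v::finite) pmf"
  assumes fin: "finite (set_pmf \<mu>)"
  shows "sensing PS W (bind_pmf \<mu> P) \<le> measure_pmf.expectation \<mu> (\<lambda>c. sensing PS W (P c))"
proof -
  define K where "K Q = (\<lambda>s. bind_pmf Q (\<lambda>x. Ws W x s))" for Q :: "'x pmf"
  define K' where "K' = K (bind_pmf \<mu> P)"
  \<comment> \<open>Log ratios frozen at the averaged law make the lower bound linear in the law, so
    it commutes with the expectation over \<mu>.\<close>
  define c where "c s v = log 2 (pmf (K' s) v / pmf (bind_pmf PS K') v)" for s v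
  have KK: "K' s = bind_pmf \<mu> (\<lambda>c. K (P c) s)" for s by (simp add: K'_def K_def bind_assoc_pmf)
  have int: "integrable (measure_pmf \<mu>) F" for F :: "_ \<Rightarrow> real"
    by (rule integrable_measure_pmf_finite[OF fin])
  \<comment> \<open>Each component of a mixture is absolutely continuous with respect to the
    mixture, as the tangent bound requires.\<close>
  have ac: "pmf (K (P c) s) v = 0" if "c \<in> set_pmf \<mu>" "pmf (K' s) v = 0" for c s v
    using that unfolding KK by (auto simp: pmf_eq_0_set_pmf set_bind_pmf)
  have "sensing PS W (bind_pmf \<mu> P) = (\<Sum>s\<in>UNIV. \<Sum>v\<in>UNIV. pmf PS s * pmf (K' s) v * c s v)"
    unfolding sensing_eq c_def chan_info_def K'_def K_def ..
  also have "\<dots> = measure_pmf.expectation \<mu> (\<lambda>d. \<Sum>s\<in>UNIV. \<Sum>v\<in>UNIV. pmf PS s * pmf (K (P d) s) v * c s v)"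
    by (simp add: KK pmf_bind int mult.commute mult.left_commute)
  also have "\<dots> \<le> measure_pmf.expectation \<mu> (\<lambda>d. sensing PS W (P d))"
  proof (intro integral_mono_AE int AE_pmfI)
    fix d assume d: "d \<in> set_pmf \<mu>"
    show "(\<Sum>s\<in>UNIV. \<Sum>v\<in>UNIV. pmf PS s * pmf (K (P d) s) v * c s v) \<le> sensing PS W (P d)"
      unfolding sensing_eq c_def using chan_info_tangent[of PS K' "K (P d)"] ac[OF d] by (simp add: K_def)
  qed
  finally show ?thesis .
qed

section \<open>Input laws as a compact convex set of vectors, and continuity on it\<close>

definition pmf_simplex :: "(real ^ 'x::finite) set" where
  "pmf_simplex = {v. (\<forall>i. 0 \<le> v $ i) \<and> (\<Sum>i\<in>UNIV. v $ i) = 1}"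

lemma compact_pmf_simplex: "compact pmf_simplex"
proof -
  have "closed ((\<Inter>i. {v :: real ^ 'x. 0 \<le> v $ i}) \<inter> {v. (\<Sum>i\<in>UNIV. v $ i) = 1})"
    by (intro closed_Int closed_INT ballI closed_Collect_le closed_Collect_eq continuous_intros)
  also have "(\<Inter>i. {v :: real ^ 'x. 0 \<le> v $ i}) \<inter> {v. (\<Sum>i\<in>UNIV. v $ i) = 1} = pmf_simplex"
    by (auto simp: pmf_simplex_def)
  finally have "closed (pmf_simplex :: (real ^ 'x) set)" .
  moreover have "norm v \<le> 1" if "v \<in> pmf_simplex" for v :: "real ^ 'x"
    using norm_le_l1_cart[of v] that by (simp add: pmf_simplex_def)
  then have "bounded (pmf_simplex :: (real ^ 'x) set)" by (auto simp: bounded_iff)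
  ultimately show ?thesis by (simp add: compact_eq_bounded_closed)
qed

lemma convex_pmf_simplex: "convex pmf_simplex"
  unfolding convex_def pmf_simplex_def
  by (auto simp: sum.distrib sum_distrib_left[symmetric])

lemma range_pmf_simplex: "range (\<lambda>P. \<chi> x. pmf P x) = (pmf_simplex :: (real ^ 'x::finite) set)"
proof (intro equalityI subsetI)
  fix v :: "real ^ 'x" assume v: "v \<in> pmf_simplex"
  have "(\<integral>\<^sup>+ x. ennreal (v $ x) \<partial>count_space UNIV) = 1"
    using v by (subst nn_integral_count_space_finite) (auto simp: pmf_simplex_def)
  then have "pmf (embed_pmf (($) v)) x = v $ x" for x
    using v by (intro pmf_embed_pmf) (auto simp: pmf_simplex_def)
  then have "v = (\<chi> x. pmf (embed_pmf (($) v)) x)" by (simp add: vec_eq_iff)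
  then show "v \<in> range (\<lambda>P. \<chi> x. pmf P x)" by blast
qed (auto simp: pmf_simplex_def)

lemma continuous_xlog2_comp:
  assumes "continuous_on S f" "\<And>x. x \<in> S \<Longrightarrow> f x \<ge> 0"
  shows "continuous_on S (\<lambda>x. xlog2 (f x))"
  using assms by (intro continuous_on_compose2[OF continuous_on_xlog2]) auto

context
  fixes PS :: "'s::finite pmf" and W :: "'x::finite \<Rightarrow> 's \<Rightarrow> ('y::finite \<times> 'v::finite) pmf"
begin

definition rate_vec :: "real ^ 'x \<Rightarrow> real" where
  "rate_vec v = (\<Sum>x\<in>UNIV. v $ x * (\<Sum>y\<in>UNIV. xlog2 (pmf (Wc PS W x) y))) -
     (\<Sum>y\<in>UNIV. xlog2 (\<Sum>x\<in>UNIV. v $ x * pmf (Wc PS W x) y))"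

definition sensing_vec :: "real ^ 'x \<Rightarrow> real" where
  "sensing_vec v = (\<Sum>s\<in>UNIV. pmf PS s * (\<Sum>z\<in>UNIV. xlog2 (\<Sum>x\<in>UNIV. v $ x * pmf (Ws W x s) z))) -
     (\<Sum>z\<in>UNIV. xlog2 (\<Sum>s\<in>UNIV. pmf PS s * (\<Sum>x\<in>UNIV. v $ x * pmf (Ws W x s) z)))"

lemma rate_vec: "rate PS W P = rate_vec (\<chi> x. pmf P x)"
  unfolding rate_eq chan_info_entropies rate_vec_def by (simp add: pmf_bind_sum)

lemma sensing_vec: "sensing PS W P = sensing_vec (\<chi> x. pmf P x)"
  unfolding sensing_eq chan_info_entropies sensing_vec_def by (simp add: pmf_bind_sum)

lemma continuous_rate_vec: "continuous_on pmf_simplex rate_vec"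
  unfolding rate_vec_def[abs_def]
  by (intro continuous_intros continuous_xlog2_comp sum_nonneg mult_nonneg_nonneg)
     (auto simp: pmf_simplex_def)

lemma continuous_sensing_vec: "continuous_on pmf_simplex sensing_vec"
  unfolding sensing_vec_def[abs_def]
  by (intro continuous_intros continuous_xlog2_comp sum_nonneg mult_nonneg_nonneg)
     (auto simp: pmf_simplex_def)

lemma single_mode_points_vec: "single_mode_points PS W = (\<lambda>v. (rate_vec v, sensing_vec v)) ` pmf_simplex"
  unfolding single_mode_points_def range_pmf_simplex[symmetric] image_image rate_vec sensing_vec ..

lemma compact_single_mode_points: "compact (single_mode_points PS W)"
  unfolding single_mode_points_vec
  by (intro compact_continuous_image continuous_on_Pair continuous_rate_vec continuous_sensing_vec compact_pmf_simplex)

text \<open>The simplex is connected and the sensing level continuous, so the attained levels form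
  an interval. This interval is the domain of the concave envelope, and \<open>concave_on\<close>
  asks for a convex one.\<close>

lemma convex_snd_single_mode_points: "convex (snd ` single_mode_points PS W)"
proof -
  have "snd ` single_mode_points PS W = sensing_vec ` pmf_simplex"
    unfolding single_mode_points_vec by (simp add: image_image)
  moreover have "connected (sensing_vec ` pmf_simplex)"
    by (intro connected_continuous_image continuous_sensing_vec convex_connected convex_pmf_simplex)
  ultimately show ?thesis using connected_iff_interval is_interval_1 is_interval_convex_1 by metis
qed

lemma nonneg_single_mode_points: "single_mode_points PS W \<subseteq> {0..} \<times> {0..}"
  by (auto simp: single_mode_points_def rate_eq sensing_eq chan_info_nonneg)

end

section \<open>Pareto boundaries of planar convex sets\<close>

text \<open>The slopes sum to zero without all vanishing, so one of them is negative. The least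
  ratio of weight to negated slope over the negative slopes is the first time at which a weight
  reaches zero.\<close>

lemma shift_weights_to_zero:
  fixes u v w \<alpha> \<beta> \<gamma> :: real
  assumes "u \<ge> 0" "v \<ge> 0" "w \<ge> 0" "\<alpha> + \<beta> + \<gamma> = 0" "(\<alpha>, \<beta>, \<gamma>) \<noteq> (0, 0, 0)"
  obtains t where "t \<ge> 0" "u + t * \<alpha> \<ge> 0" "v + t * \<beta> \<ge> 0" "w + t * \<gamma> \<ge> 0"
    "u + t * \<alpha> = 0 \<or> v + t * \<beta> = 0 \<or> w + t * \<gamma> = 0"
proof -
  define N where "N = {(u, \<alpha>), (v, \<beta>), (w, \<gamma>)}"
  define M where "M = (\<lambda>(u, \<alpha>). u / - \<alpha>) ` {z \<in> N. snd z < 0}"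
  have "\<alpha> < 0 \<or> \<beta> < 0 \<or> \<gamma> < 0" using assms by auto
  then have M: "finite M" "M \<noteq> {}" by (auto simp: M_def N_def)
  define t where "t = Min M"
  have tM: "t \<in> M" using M by (simp add: t_def)
  have t0: "t \<ge> 0" using tM assms by (auto simp: M_def N_def divide_nonneg_neg)
  have ge: "x + t * \<xi> \<ge> 0" if "(x, \<xi>) \<in> N" for x \<xi>
  proof (cases "\<xi> < 0")
    case True
    then have "x / - \<xi> \<in> M" using that by (force simp: M_def)
    then have "t \<le> x / - \<xi>" using M by (simp add: t_def)
    then show ?thesis using True by (simp add: field_simps)
  next
    case False
    then show ?thesis using that assms t0 by (auto simp: N_def)
  qed
  obtain x \<xi> where x: "(x, \<xi>) \<in> N" "\<xi> < 0" "t = x / - \<xi>" using tM by (auto simp: M_def)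
  then have "x + t * \<xi> = 0" by simp
  then show thesis using x(1) t0 ge[of u \<alpha>] ge[of v \<beta>] ge[of w \<gamma>]
    by (intro that[of t]) (auto simp: N_def)
qed

text \<open>Moving the weights of a point of a triangle along a direction in which both coordinates
  do not decrease, until a weight vanishes, shows that two points suffice for domination.\<close>

lemma convex_hull_dominated_by_two:
  fixes A :: "(real \<times> real) set"
  assumes "p \<in> convex hull A"
  obtains a b u where "a \<in> A" "b \<in> A" "0 \<le> u" "u \<le> 1"
    "fst p \<le> u * fst a + (1 - u) * fst b" "snd p \<le> u * snd a + (1 - u) * snd b"
proof -
  obtain S where S: "finite S" "S \<subseteq> A" "card S \<le> 3" "p \<in> convex hull S"
    using assms unfolding caratheodory[of A] by auto
  have "S \<noteq> {}" using S by auto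
  then have "card S = 1 \<or> card S = 2 \<or> card S = 3"
    using S(1,3) card_0_eq[of S] by linarith
  then have "\<exists>a b c. S = {a, b, c}"
    by (metis card_1_singletonE card_2_iff card_3_iff insert_absorb2)
  then obtain a b c where abc: "S = {a, b, c}" by blast
  obtain u v w where uvw: "u \<ge> 0" "v \<ge> 0" "w \<ge> 0" "u + v + w = 1"
      "p = u *\<^sub>R a + v *\<^sub>R b + w *\<^sub>R c"
    using S(4) unfolding abc convex_hull_3 by auto
  \<comment> \<open>The vector (y2, -y1) leaves the second coordinate unchanged, and its sign is
    chosen so that the first does not decrease. If this vector is zero, every direction leaves the
    second coordinate unchanged and (1, 0) or (-1, 0) serves.\<close>
  have dir: "\<exists>\<beta> \<gamma> :: real. (\<beta>, \<gamma>) \<noteq> (0, 0) \<and> \<beta> * x1 + \<gamma> * x2 \<ge> 0 \<and> \<beta> * y1 + \<gamma> * y2 \<ge> 0" for x1 y1 x2 y2 :: real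
  proof (cases "y1 = 0 \<and> y2 = 0")
    case True
    then show ?thesis by (intro exI[of _ "if x1 \<ge> 0 then 1 else -1"] exI[of _ 0]) auto
  next
    case False
    let ?s = "if y2 * x1 - y1 * x2 \<ge> 0 then 1 else (-1 :: real)"
    show ?thesis using False
      by (intro exI[of _ "?s * y2"] exI[of _ "- (?s * y1)"]) (auto simp: algebra_simps)
  qed
  obtain \<beta> \<gamma> where bc: "(\<beta>, \<gamma>) \<noteq> (0, 0)" "\<beta> * (fst b - fst a) + \<gamma> * (fst c - fst a) \<ge> 0"
      "\<beta> * (snd b - snd a) + \<gamma> * (snd c - snd a) \<ge> 0"
    using dir by blast
  \<comment> \<open>This choice keeps the total weight equal to 1.\<close>
  define \<alpha> where "\<alpha> = - \<beta> - \<gamma>"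
  obtain t where t: "t \<ge> 0" "u + t * \<alpha> \<ge> 0" "v + t * \<beta> \<ge> 0" "w + t * \<gamma> \<ge> 0"
    "u + t * \<alpha> = 0 \<or> v + t * \<beta> = 0 \<or> w + t * \<gamma> = 0"
    using shift_weights_to_zero[OF uvw(1-3), of \<alpha> \<beta> \<gamma>] bc(1) by (auto simp: \<alpha>_def)
  define u' v' w' where "u' = u + t * \<alpha>" "v' = v + t * \<beta>" "w' = w + t * \<gamma>"
  have s1: "u' + v' + w' = 1" using uvw by (simp add: u'_v'_w'_def \<alpha>_def algebra_simps)
  have nn: "u' \<ge> 0" "v' \<ge> 0" "w' \<ge> 0" and z: "u' = 0 \<or> v' = 0 \<or> w' = 0"
    using t by (auto simp: u'_v'_w'_def)
  have "u' * fst a + v' * fst b + w' * fst c = fst p + t * (\<beta> * (fst b - fst a) + \<gamma> * (fst c - fst a))"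
    by (simp add: uvw(5) u'_v'_w'_def \<alpha>_def algebra_simps)
  moreover have "u' * snd a + v' * snd b + w' * snd c = snd p + t * (\<beta> * (snd b - snd a) + \<gamma> * (snd c - snd a))"
    by (simp add: uvw(5) u'_v'_w'_def \<alpha>_def algebra_simps)
  ultimately have f: "fst p \<le> u' * fst a + v' * fst b + w' * fst c"
    and s: "snd p \<le> u' * snd a + v' * snd b + w' * snd c"
    using t(1) bc by (simp_all add: mult_nonneg_nonneg)
  have A: "a \<in> A" "b \<in> A" "c \<in> A" using S abc by auto
  consider "u' = 0" "w' = 1 - v'" | "v' = 0" "w' = 1 - u'" | "w' = 0" "v' = 1 - u'"
    using z s1 by fastforce
  then show thesis
  proof cases
    case 1 with f s nn A show ?thesis by (intro that[of b c v']) auto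
  next
    case 2 with f s nn A show ?thesis by (intro that[of a c u']) auto
  next
    case 3 with f s nn A show ?thesis by (intro that[of a b u']) auto
  qed
qed

section \<open>Segments and downward closures in the nonnegative quadrant\<close>

lemma closed_segment_down:
  fixes a b :: real
  assumes "b \<ge> 0"
  shows "closed_segment (a, b) (a, 0) = {a} \<times> {0..b}" "closed_segment (b, a) (0, a) = {0..b} \<times> {a}"
proof -
  have *: "\<exists>u. y = (1 - u) * b \<and> 0 \<le> u \<and> u \<le> 1" if "0 \<le> y" "y \<le> b" for y
    using that by (intro exI[of _ "1 - y / b"]) (cases "b = 0", auto)
  have **: "(1 - u) * a + u * a = a" for u by (simp add: algebra_simps)
  show "closed_segment (a, b) (a, 0) = {a} \<times> {0..b}" "closed_segment (b, a) (0, a) = {0..b} \<times> {a}"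
    using assms * by (auto simp: closed_segment_def ** mult_left_le_one_le)
qed

lemma in_downward_closure:
  "(R, D) \<in> downward_closure H \<longleftrightarrow> 0 \<le> R \<and> 0 \<le> D \<and> (\<exists>(R', D') \<in> H. R \<le> R' \<and> D \<le> D')"
  unfolding downward_closure_def by auto

text \<open>The set is the quadrant intersected with the Minkowski sum of the compact H and the
  closed nonpositive quadrant, and a sum of a compact and a closed set is closed.\<close>

lemma closed_downward_closure:
  assumes "compact H"
  shows "closed (downward_closure H)"
proof -
  have "downward_closure H = ({0..} \<times> {0..}) \<inter> (\<Union>x\<in>H. \<Union>y\<in>{..0} \<times> {..0}. {x + y})"
  proof (intro set_eqI iffI)
    fix p assume "p \<in> downward_closure H"
    then obtain R D R' D' where "p = (R, D)" "(R', D') \<in> H" "0 \<le> R" "0 \<le> D" "R \<le> R'" "D \<le> D'"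
      by (auto simp: downward_closure_def)
    moreover from this have "p = (R', D') + (R - R', D - D')" "(R - R', D - D') \<in> {..0} \<times> {..0}" by auto
    ultimately show "p \<in> ({0..} \<times> {0..}) \<inter> (\<Union>x\<in>H. \<Union>y\<in>{..0} \<times> {..0}. {x + y})" by blast
  next
    fix p assume "p \<in> ({0..} \<times> {0..}) \<inter> (\<Union>x\<in>H. \<Union>y\<in>{..0} \<times> {..0}. {x + y})"
    then obtain R' D' y z where "(R', D') \<in> H" "y \<le> 0" "z \<le> 0" "p = (R' + y, D' + z)" "fst p \<ge> 0" "snd p \<ge> 0"
      by auto
    then show "p \<in> downward_closure H"
      by (auto simp: downward_closure_def intro!: bexI[of _ "(R', D')"])
  qed
  moreover have "closed (\<Union>x\<in>H. \<Union>y\<in>{..0} \<times> {..0::real}. {x + y})" (is "closed ?N")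
    by (intro compact_closed_sums assms closed_Times closed_atMost)
  moreover have "closed ({0::real..} \<times> {0::real..})" by (intro closed_Times closed_atLeast)
  ultimately show ?thesis by auto
qed

text \<open>A point of C is interior relative to the quadrant exactly when another point of C
  exceeds it in both coordinates: the box below that point is relatively open and stays in C, and
  every neighbourhood contains a point up and to the right. Since C is closed, the frontier is what
  remains of C.\<close>

lemma outer_boundary_downward_closure:
  assumes "compact H"
  defines "C \<equiv> downward_closure H"
  shows "outer_boundary C = {(R, D) \<in> C. \<forall>(R', D') \<in> C. \<not> (R < R' \<and> D < D')}"
proof -
  let ?Q = "{0::real..} \<times> {0::real..}"
  have CQ: "C \<subseteq> ?Q" by (auto simp: C_def downward_closure_def)
  have "closed C" unfolding C_def by (rule closed_downward_closure) fact
  then have "closedin (top_of_set ?Q) C" using CQ by (simp add: closed_subset)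
  then have cl: "(top_of_set ?Q) closure_of C = C" by (rule closure_of_closedin)
  have int: "(R, D) \<in> (top_of_set ?Q) interior_of C \<longleftrightarrow> (\<exists>(R', D') \<in> C. R < R' \<and> D < D')"
    if "(R, D) \<in> C" for R D
  proof
    assume "(R, D) \<in> (top_of_set ?Q) interior_of C"
    then obtain U where U: "open U" "(R, D) \<in> U" "?Q \<inter> U \<subseteq> C"
      by (auto simp: interior_of_def openin_open)
    obtain X Y where XY: "open X" "open Y" "(R, D) \<in> X \<times> Y" "X \<times> Y \<subseteq> U"
      using open_prod_elim[OF U(1,2)] by metis
    obtain e where e: "e > 0" "ball R e \<subseteq> X" using XY by (auto simp: open_contains_ball)
    obtain d where d: "d > 0" "ball D d \<subseteq> Y" using XY by (auto simp: open_contains_ball)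
    have "R + e / 2 \<in> X" "D + d / 2 \<in> Y" using e d by (auto simp: subset_iff dist_real_def)
    moreover have "0 \<le> R" "0 \<le> D" using that CQ by auto
    ultimately have "(R + e / 2, D + d / 2) \<in> C" using U XY e d by (auto simp: subset_iff)
    then show "\<exists>(R', D') \<in> C. R < R' \<and> D < D'" using e d by force
  next
    assume "\<exists>(R', D') \<in> C. R < R' \<and> D < D'"
    then obtain R' D' where *: "(R', D') \<in> C" "R < R'" "D < D'" by auto
    have "?Q \<inter> ({..<R'} \<times> {..<D'}) \<subseteq> C"
    proof (rule subrelI)
      fix a b assume "(a, b) \<in> ?Q \<inter> ({..<R'} \<times> {..<D'})"
      moreover obtain R3 D3 where "(R3, D3) \<in> H" "R' \<le> R3" "D' \<le> D3"
        using *(1) by (auto simp: C_def in_downward_closure)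
      ultimately show "(a, b) \<in> C"
        unfolding C_def in_downward_closure by (auto intro!: bexI[of _ "(R3, D3)"])
    qed
    moreover have "openin (top_of_set ?Q) (?Q \<inter> ({..<R'} \<times> {..<D'}))"
      by (intro openin_open_Int open_Times open_lessThan)
    ultimately show "(R, D) \<in> (top_of_set ?Q) interior_of C"
      unfolding interior_of_def using * that CQ by (auto intro!: exI[of _ "?Q \<inter> ({..<R'} \<times> {..<D'})"])
  qed
  show ?thesis unfolding outer_boundary_def frontier_of_def cl using int by auto
qed

section \<open>Envelope, Pareto points and outer boundary for a compact set of modes\<close>

locale planar_frontier =
  fixes A :: "(real \<times> real) set"
  assumes compact_A: "compact A" and nonempty_A: "A \<noteq> {}"
    and nonneg_A: "A \<subseteq> {0..} \<times> {0..}" and convex_snd: "convex (snd ` A)"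
begin

definition "H = convex hull A"
definition "C = downward_closure H"
definition "T = tradeoff_boundary C"

lemma compact_H: "compact H" unfolding H_def by (rule compact_convex_hull[OF compact_A])

lemma convex_H: "convex H" unfolding H_def by simp

lemma A_H: "A \<subseteq> H" unfolding H_def by (rule hull_subset)

lemma nonneg_H: "H \<subseteq> {0..} \<times> {0..}"
  unfolding H_def by (intro hull_minimal nonneg_A convex_Times) auto

lemma H_C: "H \<subseteq> C"
  using nonneg_H by (force simp: C_def downward_closure_def)

text \<open>A maximal point is dominated by some point of H, which belongs to C, and by maximality
  coincides with it.\<close>

lemma T_H: "T \<subseteq> H"
proof (rule subrelI)
  fix R D assume *: "(R, D) \<in> T"
  then have "(R, D) \<in> C" by (auto simp: T_def tradeoff_boundary_def)
  then obtain R' D' where h: "(R', D') \<in> H" "R \<le> R'" "D \<le> D'" by (auto simp: C_def in_downward_closure)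
  with H_C * have "R' = R \<and> D' = D" by (fastforce simp: T_def tradeoff_boundary_def)
  with h show "(R, D) \<in> H" by simp
qed

lemma T_maximal: "(R, D) \<in> T \<Longrightarrow> (R', D') \<in> C \<Longrightarrow> R \<le> R' \<Longrightarrow> D \<le> D' \<Longrightarrow> R' = R \<and> D' = D"
  by (fastforce simp: T_def tradeoff_boundary_def)

text \<open>Maximising the sum of the coordinates over the dominating points gives a Pareto point.\<close>

lemma dominated_by_T:
  assumes "(R, D) \<in> C"
  obtains R' D' where "(R', D') \<in> T" "R \<le> R'" "D \<le> D'"
proof -
  define K where "K = H \<inter> ({R..} \<times> {D..})"
  have "closed ({R..} \<times> {D..})" by (intro closed_Times closed_atLeast)
  then have K: "compact K" unfolding K_def by (intro compact_Int_closed compact_H)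
  have Kne: "K \<noteq> {}" using assms by (auto simp: K_def C_def in_downward_closure)
  have "\<exists>h\<in>K. \<forall>k\<in>K. fst k + snd k \<le> fst h + snd h"
    by (rule continuous_attains_sup[OF K Kne]) (intro continuous_intros)
  then obtain h where h: "h \<in> K" "\<And>k. k \<in> K \<Longrightarrow> fst k + snd k \<le> fst h + snd h"
    by blast
  obtain R' D' where hRD: "h = (R', D')" by (cases h)
  have "(R', D') \<in> T" unfolding T_def tradeoff_boundary_def
  proof (safe; (simp only: split_paired_all)?)
    show "(R', D') \<in> C" using h hRD H_C by (auto simp: K_def)
    fix R'' D'' assume a: "(R'', D'') \<in> C" "R' \<le> R''" "D' \<le> D''"
    then obtain R3 D3 where 3: "(R3, D3) \<in> H" "R'' \<le> R3" "D'' \<le> D3" by (auto simp: C_def in_downward_closure)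
    have "(R3, D3) \<in> K" using 3 a h(1) hRD by (auto simp: K_def)
    from h(2)[OF this] show "R'' = R'" "D'' = D'" using 3 a hRD by auto
  qed
  then show thesis using h hRD by (intro that[of R' D']) (auto simp: K_def)
qed

lemma H_ne: "H \<noteq> {}" using A_H nonempty_A by auto

text \<open>\<open>rate_endpoint\<close> is formed from a separate supremum and infimum; it is a
  point of T because the Pareto point of greatest rate also has the least sensing level among Pareto
  points.\<close>

lemma rate_endpoint_props:
  obtains Rm Dr where "rate_endpoint T = (Rm, Dr)" "(Rm, Dr) \<in> T"
    "\<And>R D. (R, D) \<in> C \<Longrightarrow> R \<le> Rm" "\<And>R D. (R, D) \<in> T \<Longrightarrow> Dr \<le> D" "Dr \<in> snd ` A"
proof -
  have "\<exists>h\<in>H. \<forall>k\<in>H. fst k \<le> fst h"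
    by (rule continuous_attains_sup[OF compact_H H_ne]) (intro continuous_intros)
  then obtain h where h: "h \<in> H" "\<And>k. k \<in> H \<Longrightarrow> fst k \<le> fst h"
    by blast
  obtain Rm Dr where t: "(Rm, Dr) \<in> T" "fst h \<le> Rm"
    using dominated_by_T[of "fst h" "snd h"] h(1) H_C by (metis prod.collapse subsetD)
  have mx: "R \<le> Rm" if "(R, D) \<in> C" for R D
  proof -
    obtain R' D' where "(R', D') \<in> H" "R \<le> R'" using \<open>(R, D) \<in> C\<close> by (auto simp: C_def in_downward_closure)
    then show ?thesis using h(2)[of "(R', D')"] t(2) by simp
  qed
  have TC: "T \<subseteq> C" using T_H H_C by auto
  have mn: "Dr \<le> D" if "(R, D) \<in> T" for R D
  proof (rule ccontr)
    assume "\<not> Dr \<le> D"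
    then show False using T_maximal[OF that, of Rm Dr] mx[of R D] that TC t(1) by auto
  qed
  have "Sup (fst ` T) = Rm"
    using t(1) mx TC by (intro cSup_eq_maximum) (auto intro: rev_image_eqI)
  moreover have "Inf (snd ` T) = Dr"
    using t(1) mn by (intro cInf_eq_minimum) (auto intro: rev_image_eqI)
  ultimately have e: "rate_endpoint T = (Rm, Dr)" by (simp add: rate_endpoint_def)
  \<comment> \<open>The endpoint is the lexicographic maximum of H, rate first and then sensing
    level. This makes it extreme, and extreme points of a hull belong to the generating set.\<close>
  have "(Rm, Dr) extreme_point_of H"
    unfolding extreme_point_of_def
  proof safe
    show "(Rm, Dr) \<in> H" using t(1) T_H by auto
    fix R1 D1 R2 D2 assume H: "(R1, D1) \<in> H" "(R2, D2) \<in> H" and seg: "(Rm, Dr) \<in> open_segment (R1, D1) (R2, D2)"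
    then obtain u where u: "0 < u" "u < 1" "Rm = (1 - u) * R1 + u * R2" "Dr = (1 - u) * D1 + u * D2"
      and ne: "(R1, D1) \<noteq> (R2, D2)" by (auto simp: in_segment)
    have R: "R1 \<le> Rm" "R2 \<le> Rm" using H H_C mx by auto
    \<comment> \<open>An average that attains the upper bound of both ends forces both ends to
      attain it; the same argument is repeated for the second coordinate below.\<close>
    have "(1 - u) * (Rm - R1) + u * (Rm - R2) = 0" using u(3) by (simp add: algebra_simps)
    moreover have "(1 - u) * (Rm - R1) \<ge> 0" "u * (Rm - R2) \<ge> 0" using u R by auto
    ultimately have "(1 - u) * (Rm - R1) = 0" "u * (Rm - R2) = 0" by linarith+
    then have RR: "R1 = Rm" "R2 = Rm" using u by auto
    have "(Rm, D1) \<in> C" "(Rm, D2) \<in> C" using H H_C RR by auto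
    then have D: "D1 \<le> Dr" "D2 \<le> Dr"
      using T_maximal[OF t(1), of Rm D1] T_maximal[OF t(1), of Rm D2] by linarith+
    have "(1 - u) * (Dr - D1) + u * (Dr - D2) = 0" using u(4) by (simp add: algebra_simps)
    moreover have "(1 - u) * (Dr - D1) \<ge> 0" "u * (Dr - D2) \<ge> 0" using u D by auto
    ultimately have "(1 - u) * (Dr - D1) = 0" "u * (Dr - D2) = 0" by linarith+
    then have "D1 = Dr" "D2 = Dr" using u by auto
    with RR ne show False by simp
  qed
  then have "(Rm, Dr) \<in> A" unfolding H_def by (rule extreme_point_of_convex_hull)
  then show thesis using that e t(1) mx mn by force
qed

text \<open>The greatest sensing level of the hull is already attained on A, since the half plane
  below the maximum over A is convex and so contains H.\<close>

lemma sensing_endpoint_props: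
  obtains Rs Dm where "sensing_endpoint T = (Rs, Dm)" "(Rs, Dm) \<in> T"
    "\<And>R D. (R, D) \<in> C \<Longrightarrow> D \<le> Dm" "\<And>R D. (R, D) \<in> T \<Longrightarrow> Rs \<le> R" "Dm \<in> snd ` A"
proof -
  have "\<exists>h\<in>A. \<forall>k\<in>A. snd k \<le> snd h"
    by (rule continuous_attains_sup[OF compact_A nonempty_A]) (intro continuous_intros)
  then obtain h where h: "h \<in> A" "\<And>k. k \<in> A \<Longrightarrow> snd k \<le> snd h"
    by blast
  have "H \<subseteq> UNIV \<times> {..snd h}"
    unfolding H_def using h(2) by (intro hull_minimal convex_Times) auto
  then have hH: "D \<le> snd h" if "(R, D) \<in> H" for R D using that by auto
  obtain Rs Dm where t: "(Rs, Dm) \<in> T" "snd h \<le> Dm"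
    using dominated_by_T[of "fst h" "snd h"] h(1) H_C A_H by (metis prod.collapse subsetD)
  have TC: "T \<subseteq> C" using T_H H_C by auto
  have mx: "D \<le> Dm" if "(R, D) \<in> C" for R D
  proof -
    obtain R' D' where "(R', D') \<in> H" "D \<le> D'" using \<open>(R, D) \<in> C\<close> by (auto simp: C_def in_downward_closure)
    then show ?thesis using hH[of R' D'] t(2) by simp
  qed
  have mn: "Rs \<le> R" if "(R, D) \<in> T" for R D
  proof (rule ccontr)
    assume "\<not> Rs \<le> R"
    then show False using T_maximal[OF that, of Rs Dm] mx[of R D] that TC t(1) by auto
  qed
  have "Sup (snd ` T) = Dm"
    using t(1) mx TC by (intro cSup_eq_maximum) (auto intro: rev_image_eqI)
  moreover have "Inf (fst ` T) = Rs"
    using t(1) mn by (intro cInf_eq_minimum) (auto intro: rev_image_eqI)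
  ultimately have e: "sensing_endpoint T = (Rs, Dm)" by (simp add: sensing_endpoint_def)
  have "Dm = snd h" using t T_H hH by fastforce
  then have "Dm \<in> snd ` A" using h by auto
  then show thesis using that e t(1) mx mn by blast
qed

lemma snd_H: "snd ` H = snd ` A"
proof -
  have "snd ` H = convex hull (snd ` A)" unfolding H_def
    by (rule convex_hull_linear_image) (simp add: linear_snd)
  then show ?thesis using convex_snd by (simp add: hull_same)
qed

definition "env d = Sup {r. (r, d) \<in> H}"

text \<open>Horizontal slices of the compact H are compact, so the supremum is attained wherever the
  slice is nonempty.\<close>

lemma env_max: "(r, d) \<in> H \<Longrightarrow> r \<le> env d" and env_in: "d \<in> snd ` A \<Longrightarrow> (env d, d) \<in> H"
proof -
  have c: "compact {r. (r, d) \<in> H}" for d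
  proof -
    have "closed (UNIV \<times> {d} :: (real \<times> real) set)" by (intro closed_Times) auto
    then have "compact (fst ` (H \<inter> UNIV \<times> {d}))"
      by (intro compact_continuous_image continuous_intros compact_Int_closed compact_H)
    also have "fst ` (H \<inter> UNIV \<times> {d}) = {r. (r, d) \<in> H}" by force
    finally show ?thesis .
  qed
  show "r \<le> env d" if "(r, d) \<in> H"
    unfolding env_def using that c[of d] by (intro cSup_upper) (auto intro: bounded_imp_bdd_above compact_imp_bounded)
  show "(env d, d) \<in> H" if "d \<in> snd ` A"
  proof -
    have "{r. (r, d) \<in> H} \<noteq> {}" using that snd_H by (force simp: image_iff)
    then have "Sup {r. (r, d) \<in> H} \<in> {r. (r, d) \<in> H}"
      using c[of d] by (intro closed_contains_Sup) (auto intro: bounded_imp_bdd_above compact_imp_bounded compact_imp_closed)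
    then show ?thesis by (simp add: env_def)
  qed
qed

text \<open>Concavity comes from mixing two attained points of the graph inside the convex H. For
  minimality, the region below a concave majorant of the frontier is convex and contains A, hence
  contains H and every point of the graph.\<close>

lemma env_envelope: "is_upper_concave_envelope (snd ` A) (upper_boundary A) env"
  unfolding is_upper_concave_envelope_def
proof (intro conjI allI impI ballI)
  show "concave_on (snd ` A) env"
    unfolding concave_on_iff
  proof (intro conjI convex_snd ballI allI impI)
    fix x y u v :: real assume *: "x \<in> snd ` A" "y \<in> snd ` A" "0 \<le> u" "0 \<le> v" "u + v = 1"
    have "u *\<^sub>R (env x, x) + v *\<^sub>R (env y, y) \<in> H"
      by (intro convexD[OF convex_H] env_in *)
    then show "u * env x + v * env y \<le> env (u *\<^sub>R x + v *\<^sub>R y)" by (intro env_max) simp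
  qed
  show "upper_boundary A d \<le> env d" if "d \<in> snd ` A" for d
    unfolding upper_boundary_def using that A_H by (intro cSup_least env_max) force+
  fix h d assume h: "concave_on (snd ` A) h \<and> (\<forall>d\<in>snd ` A. upper_boundary A d \<le> h d)" and d: "d \<in> snd ` A"
  define G where "G = {(r, d). d \<in> snd ` A \<and> r \<le> h d}"
  have "convex G"
  proof (rule convexI)
    fix p q :: "real \<times> real" and u v :: real
    assume *: "p \<in> G" "q \<in> G" "0 \<le> u" "0 \<le> v" "u + v = 1"
    obtain r1 d1 r2 d2 where pq: "p = (r1, d1)" "q = (r2, d2)" by (cases p, cases q)
    have c: "u *\<^sub>R d1 + v *\<^sub>R d2 \<in> snd ` A"
      using * pq by (intro convexD[OF convex_snd]) (auto simp: G_def)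
    have "u * r1 + v * r2 \<le> u * h d1 + v * h d2"
      using * pq by (intro add_mono mult_left_mono) (auto simp: G_def)
    also have "\<dots> \<le> h (u *\<^sub>R d1 + v *\<^sub>R d2)"
      using h * pq unfolding concave_on_iff by (auto simp: G_def)
    finally show "u *\<^sub>R p + v *\<^sub>R q \<in> G" using c by (simp add: G_def pq)
  qed
  moreover have "A \<subseteq> G"
  proof (rule subrelI)
    fix r e assume re: "(r, e) \<in> A"
    have "bdd_above (fst ` A)"
      by (intro bounded_imp_bdd_above compact_imp_bounded compact_continuous_image compact_A continuous_intros)
    then have "bdd_above {r. (r, e) \<in> A}" by (rule bdd_above_mono) force
    then have "r \<le> upper_boundary A e" unfolding upper_boundary_def using re by (intro cSup_upper) auto
    moreover have "e \<in> snd ` A" using re by force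
    ultimately show "(r, e) \<in> G" using h unfolding G_def by fastforce
  qed
  ultimately have "H \<subseteq> G" unfolding H_def by (rule hull_minimal[rotated])
  then show "env d \<le> h d" using env_in[OF d] by (auto simp: G_def)
qed

text \<open>The nontrivial inclusion says that \<open>env\<close> loses rate at every step between
  the endpoints. If a graph point at d were dominated by a Pareto point at a larger D', the chord
  from the rate endpoint to that point would lie in H and force its rate up to \<open>Rm\<close>,
  contradicting maximality of the endpoint.\<close>

lemma T_graph:
  "{snd (rate_endpoint T)..snd (sensing_endpoint T)} \<subseteq> snd ` A"
  "T = (\<lambda>d. (env d, d)) ` {snd (rate_endpoint T)..snd (sensing_endpoint T)}"
proof -
  obtain Rm Dr where r: "rate_endpoint T = (Rm, Dr)" "(Rm, Dr) \<in> T"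
    "\<And>R D. (R, D) \<in> C \<Longrightarrow> R \<le> Rm" "\<And>R D. (R, D) \<in> T \<Longrightarrow> Dr \<le> D" "Dr \<in> snd ` A"
    by (rule rate_endpoint_props) blast
  obtain Rs Dm where s: "sensing_endpoint T = (Rs, Dm)" "(Rs, Dm) \<in> T"
    "\<And>R D. (R, D) \<in> C \<Longrightarrow> D \<le> Dm" "\<And>R D. (R, D) \<in> T \<Longrightarrow> Rs \<le> R" "Dm \<in> snd ` A"
    by (rule sensing_endpoint_props) blast
  have TC: "T \<subseteq> C" using T_H H_C by auto
  have "is_interval (snd ` A)" using convex_snd by (simp add: is_interval_convex_1)
  then have sub: "{Dr..Dm} \<subseteq> snd ` A"
    using r(5) s(5) unfolding is_interval_1 by (meson atLeastAtMost_iff subsetI)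
  then show "{snd (rate_endpoint T)..snd (sensing_endpoint T)} \<subseteq> snd ` A" by (simp add: r s)
  have "T = (\<lambda>d. (env d, d)) ` {Dr..Dm}"
  proof (intro equalityI subrelI)
    fix R D assume t: "(R, D) \<in> T"
    have D: "D \<in> {Dr..Dm}" using t TC r(4) s(3) by auto
    have "(env D, D) \<in> C" using env_in[OF subsetD[OF sub D]] H_C by (rule subsetD[rotated])
    moreover have "R \<le> env D" using t T_H env_max[of R D] by blast
    ultimately have "env D = R" using T_maximal[OF t] by auto
    then show "(R, D) \<in> (\<lambda>d. (env d, d)) ` {Dr..Dm}" using D by auto
  next
    fix R d assume "(R, d) \<in> (\<lambda>d. (env d, d)) ` {Dr..Dm}"
    then have d: "d \<in> {Dr..Dm}" and R: "R = env d" by auto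
    have gH: "(env d, d) \<in> H" by (rule env_in[OF subsetD[OF sub d]])
    then obtain R' D' where t: "(R', D') \<in> T" "env d \<le> R'" "d \<le> D'"
      using dominated_by_T[of "env d" d] H_C by auto
    show "(R, d) \<in> T"
    proof (cases "D' = d")
      case True
      then have "R' \<le> env d" using t(1) T_H env_max[of R' d] by blast
      then show ?thesis using t True R by auto
    next
      case False
      \<comment> \<open>The weight at which the chord from the rate endpoint to (R', D') passes over
        d.\<close>
      define l where "l = (D' - d) / (D' - Dr)"
      have l: "l > 0" "l \<le> 1" and lD: "l * (D' - Dr) = D' - d"
        using False t d by (auto simp: l_def)
      have l3: "l * Dr + (1 - l) * D' = d" using lD by (simp add: algebra_simps)
      have "l *\<^sub>R (Rm, Dr) + (1 - l) *\<^sub>R (R', D') \<in> H"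
        using r(2) t(1) T_H l by (intro convexD[OF convex_H]) auto
      then have "l * Rm + (1 - l) * R' \<le> env d" using l3 by (intro env_max) simp
      then have "l * (Rm - R') \<le> 0" using t(2) by (simp add: algebra_simps)
      then have "Rm \<le> R'" using l(1) by (simp add: mult_le_0_iff)
      then have "D' = Dr" using T_maximal[OF r(2), of R' D'] t TC d False by auto
      then show ?thesis using False t d by auto
    qed
  qed
  then show "T = (\<lambda>d. (env d, d)) ` {snd (rate_endpoint T)..snd (sensing_endpoint T)}"
    unfolding r s snd_conv .
qed

lemma C_eq: "C = downward_closure T"
proof (intro equalityI subrelI)
  fix R D assume c: "(R, D) \<in> C"
  then have "0 \<le> R" "0 \<le> D" by (auto simp: C_def in_downward_closure)
  moreover obtain R' D' where "(R', D') \<in> T" "R \<le> R'" "D \<le> D'" using dominated_by_T[OF c] .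
  ultimately show "(R, D) \<in> downward_closure T" unfolding in_downward_closure by blast
next
  fix R D assume "(R, D) \<in> downward_closure T"
  then show "(R, D) \<in> C" using T_H unfolding C_def in_downward_closure by blast
qed

text \<open>A frontier point outside T agrees in one coordinate with a Pareto point above it and has
  slack in the other. Unless the shared coordinate is the global maximum, moving that Pareto point
  slightly towards the corresponding endpoint gains there and still uses only part of the slack,
  which gives strict domination in both coordinates.\<close>

lemma outer_boundary_eq: "outer_boundary C = T \<union> rate_extension T \<union> sensing_extension T"
proof -
  obtain Rm Dr where r: "rate_endpoint T = (Rm, Dr)" "(Rm, Dr) \<in> T"
    "\<And>R D. (R, D) \<in> C \<Longrightarrow> R \<le> Rm" "\<And>R D. (R, D) \<in> T \<Longrightarrow> Dr \<le> D" "Dr \<in> snd ` A"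
    by (rule rate_endpoint_props) blast
  obtain Rs Dm where s: "sensing_endpoint T = (Rs, Dm)" "(Rs, Dm) \<in> T"
    "\<And>R D. (R, D) \<in> C \<Longrightarrow> D \<le> Dm" "\<And>R D. (R, D) \<in> T \<Longrightarrow> Rs \<le> R" "Dm \<in> snd ` A"
    by (rule sensing_endpoint_props) blast
  have TC: "T \<subseteq> C" using T_H H_C by auto
  have nn: "0 \<le> Rm" "0 \<le> Dr" "0 \<le> Rs" "0 \<le> Dm" using r(2) s(2) T_H nonneg_H by auto
  have re: "rate_extension T = {Rm} \<times> {0..Dr}"
    unfolding rate_extension_def r by (simp add: closed_segment_down nn)
  have se: "sensing_extension T = {0..Rs} \<times> {Dm}"
    unfolding sensing_extension_def s by (simp add: closed_segment_down nn)
  have ob: "outer_boundary C = {(R, D) \<in> C. \<forall>(R', D') \<in> C. \<not> (R < R' \<and> D < D')}"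
    unfolding C_def by (rule outer_boundary_downward_closure[OF compact_H])
  have mix: "((1 - e) * a + e * a', (1 - e) * b + e * b') \<in> C"
    if "(a, b) \<in> T" "(a', b') \<in> T" "0 \<le> e" "e \<le> 1" for a b a' b' e
    using convexD[OF convex_H, of "(a, b)" "(a', b')" "1 - e" e] that T_H H_C by auto
  \<comment> \<open>Moving from D' by the weight e costs at most e * D', which is less than e * (D'
    + 1) = D' - D. The added 1 gives the strict inequality and a positive denominator.\<close>
  have less: "D < (1 - e) * D' + e * D''" if "0 \<le> D" "D < D'" "0 \<le> D''" "e = (D' - D) / (D' + 1)" for D D' D'' e :: real
  proof -
    have e: "e > 0" "e * (D' + 1) = D' - D" using that by auto
    have "(1 - e) * D' + e * D'' = D' - e * (D' + 1) + e + e * D''" by (simp add: algebra_simps)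
    also have "\<dots> > D" using e that by (simp add: add_pos_nonneg)
    finally show ?thesis .
  qed
  have conv: "(1 - e) * x + e * y > x" if "e > 0" "x < y" for e x y :: real
  proof -
    have "e * (y - x) > 0" using that by simp
    then show ?thesis by (simp add: algebra_simps)
  qed
  show ?thesis unfolding ob re se
  proof (intro equalityI subrelI)
    fix R D assume "(R, D) \<in> {(R, D) \<in> C. \<forall>(R', D') \<in> C. \<not> (R < R' \<and> D < D')}"
    then have c: "(R, D) \<in> C" and mx: "\<And>R' D'. (R', D') \<in> C \<Longrightarrow> R < R' \<Longrightarrow> D < D' \<Longrightarrow> False" by auto
    have RD: "0 \<le> R" "0 \<le> D" using c by (auto simp: C_def in_downward_closure)
    obtain R' D' where t: "(R', D') \<in> T" "R \<le> R'" "D \<le> D'" using dominated_by_T[OF c] .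
    have "\<not> (R < R' \<and> D < D')" using mx[of R' D'] t(1) TC by blast
    then consider "R' = R" "D' = D" | "R' = R" "D < D'" | "D' = D" "R < R'" using t(2,3) by linarith
    then show "(R, D) \<in> T \<union> {Rm} \<times> {0..Dr} \<union> {0..Rs} \<times> {Dm}"
    proof cases
      case 1 then show ?thesis using t by auto
    next
      case 2
      have "R = Rm"
      proof (rule ccontr)
        assume "R \<noteq> Rm"
        then have "R < Rm" using r(3) c by fastforce
        define e where "e = (D' - D) / (D' + 1)"
        have e: "0 < e" "e \<le> 1" using 2 RD by (auto simp: e_def)
        have "R < (1 - e) * R' + e * Rm" using conv[OF e(1) \<open>R < Rm\<close>] 2 by simp
        moreover have "D < (1 - e) * D' + e * Dr" by (rule less[OF RD(2) 2(2) nn(2) e_def])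
        ultimately show False by (rule mx[OF mix[OF t(1) r(2) less_imp_le[OF e(1)] e(2)]])
      qed
      moreover then have "D' = Dr" using T_maximal[OF r(2), of R' D'] t(1) TC 2 r(4) by auto
      ultimately show ?thesis using 2 RD by auto
    next
      case 3
      have "D = Dm"
      proof (rule ccontr)
        assume "D \<noteq> Dm"
        then have "D < Dm" using s(3) c by fastforce
        define e where "e = (R' - R) / (R' + 1)"
        have e: "0 < e" "e \<le> 1" using 3 RD by (auto simp: e_def)
        have "D < (1 - e) * D' + e * Dm" using conv[OF e(1) \<open>D < Dm\<close>] 3 by simp
        moreover have "R < (1 - e) * R' + e * Rs" by (rule less[OF RD(1) 3(2) nn(3) e_def])
        ultimately show False
          using mx[OF mix[OF t(1) s(2) less_imp_le[OF e(1)] e(2)]] by blast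
      qed
      moreover then have "R' = Rs" using T_maximal[OF s(2), of R' D'] t(1) TC 3 s(4) by auto
      ultimately show ?thesis using 3 RD by auto
    qed
  next
    fix R D assume "(R, D) \<in> T \<union> {Rm} \<times> {0..Dr} \<union> {0..Rs} \<times> {Dm}"
    then consider "(R, D) \<in> T" | "R = Rm" "0 \<le> D" "D \<le> Dr" | "D = Dm" "0 \<le> R" "R \<le> Rs" by auto
    then show "(R, D) \<in> {(R, D) \<in> C. \<forall>(R', D') \<in> C. \<not> (R < R' \<and> D < D')}"
    proof cases
      case 1 then show ?thesis using TC T_maximal[OF 1] by (auto; metis less_imp_le order_less_irrefl)
    next
      case 2
      then have "(R, D) \<in> C" using r(2) nn unfolding C_eq in_downward_closure by auto
      then show ?thesis using r(3) 2 by (auto simp: not_less)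
    next
      case 3
      then have "(R, D) \<in> C" using s(2) nn unfolding C_eq in_downward_closure by auto
      then show ?thesis using s(3) 3 by (auto simp: not_less)
    qed
  qed
qed

text \<open>Pareto points have sensing level at least \<open>Dr\<close> and rate at least
  \<open>Rs\<close>, so a segment running down or left from an endpoint meets T again nowhere else;
  a nonzero coordinate gives it positive length.\<close>

lemma endpoint_extensions:
  "rate_endpoint T \<in> T" "sensing_endpoint T \<in> T"
  "snd (rate_endpoint T) \<noteq> 0 \<Longrightarrow> {rate_endpoint T} \<subset> rate_extension T"
  "rate_extension T \<inter> T = {rate_endpoint T}"
  "fst (sensing_endpoint T) \<noteq> 0 \<Longrightarrow> {sensing_endpoint T} \<subset> sensing_extension T"
  "sensing_extension T \<inter> T = {sensing_endpoint T}"
proof -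
  obtain Rm Dr where r: "rate_endpoint T = (Rm, Dr)" "(Rm, Dr) \<in> T"
    "\<And>R D. (R, D) \<in> C \<Longrightarrow> R \<le> Rm" "\<And>R D. (R, D) \<in> T \<Longrightarrow> Dr \<le> D" "Dr \<in> snd ` A"
    by (rule rate_endpoint_props) blast
  obtain Rs Dm where s: "sensing_endpoint T = (Rs, Dm)" "(Rs, Dm) \<in> T"
    "\<And>R D. (R, D) \<in> C \<Longrightarrow> D \<le> Dm" "\<And>R D. (R, D) \<in> T \<Longrightarrow> Rs \<le> R" "Dm \<in> snd ` A"
    by (rule sensing_endpoint_props) blast
  have nn: "0 \<le> Rm" "0 \<le> Dr" "0 \<le> Rs" "0 \<le> Dm" using r(2) s(2) T_H nonneg_H by auto
  have re: "rate_extension T = {Rm} \<times> {0..Dr}"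
    unfolding rate_extension_def r by (simp add: closed_segment_down nn)
  have se: "sensing_extension T = {0..Rs} \<times> {Dm}"
    unfolding sensing_extension_def s by (simp add: closed_segment_down nn)
  show "rate_endpoint T \<in> T" "sensing_endpoint T \<in> T" using r s by auto
  show "{rate_endpoint T} \<subset> rate_extension T" if "snd (rate_endpoint T) \<noteq> 0"
  proof -
    have "(Rm, 0) \<in> rate_extension T - {rate_endpoint T}" "rate_endpoint T \<in> rate_extension T"
      using that nn by (auto simp: re r(1))
    then show ?thesis by blast
  qed
  show "rate_extension T \<inter> T = {rate_endpoint T}" unfolding re r using r(2) r(4) nn by fastforce
  show "{sensing_endpoint T} \<subset> sensing_extension T" if "fst (sensing_endpoint T) \<noteq> 0"
  proof -
    have "(0, Dm) \<in> sensing_extension T - {sensing_endpoint T}" "sensing_endpoint T \<in> sensing_extension T"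
      using that nn by (auto simp: se s(1))
    then show ?thesis by blast
  qed
  show "sensing_extension T \<inter> T = {sensing_endpoint T}" unfolding se s using s(2) s(4) nn by fastforce
qed

end

section \<open>Converse\<close>

definition word_law :: "nat \<Rightarrow> (nat \<Rightarrow> 'a pmf) \<Rightarrow> (nat \<Rightarrow> 'a) pmf" where
  "word_law n p = Pi_pmf {..<n} undefined p"

text \<open>The set \<open>{..<n} \<rightarrow>\<^sub>E UNIV\<close>, written with the default value
  of \<open>Pi_pmf\<close> so that supports of word laws fit into it directly.\<close>

definition words :: "nat \<Rightarrow> (nat \<Rightarrow> 'a) set" where
  "words n = PiE_dflt {..<n} undefined (\<lambda>_. UNIV)"

lemma finite_words: "finite (words n :: (nat \<Rightarrow> 'a::finite) set)"
  unfolding words_def by (intro finite_PiE_dflt) auto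

lemma words_eq: "words n = {..<n} \<rightarrow>\<^sub>E UNIV"
  by (auto simp: words_def PiE_dflt_def PiE_def extensional_def)

lemma set_word_law: "set_pmf (word_law n p) \<subseteq> words n"
  unfolding word_law_def words_def by (rule order_trans[OF set_Pi_pmf_subset']) (auto simp: PiE_dflt_def)

lemma finite_set_word_law: "finite (set_pmf (word_law n p))" for p :: "nat \<Rightarrow> 'a::finite pmf"
  by (rule finite_subset[OF set_word_law finite_words])

lemma expectation_word_law:
  fixes p :: "nat \<Rightarrow> 'a::finite pmf" and F :: "_ \<Rightarrow> real"
  shows "measure_pmf.expectation (word_law n p) F = (\<Sum>y\<in>words n. pmf (word_law n p) y * F y)"
  using set_word_law[of n p] by (subst integral_measure_pmf[OF finite_words]) auto

lemma pmf_word_law: "y \<in> words n \<Longrightarrow> pmf (word_law n p) y = (\<Prod>i<n. pmf (p i) (y i))"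
  unfolding word_law_def by (rule pmf_Pi') (auto simp: words_def PiE_dflt_def)

lemma word_law_component: "i < n \<Longrightarrow> map_pmf (\<lambda>y. y i) (word_law n p) = p i"
  unfolding word_law_def by (subst Pi_pmf_component) auto

lemma expectation_word_law_component:
  fixes F :: "_ \<Rightarrow> real"
  assumes "i < n"
  shows "measure_pmf.expectation (word_law n p) (\<lambda>y. F (y i)) = measure_pmf.expectation (p i) F"
  unfolding word_law_component[OF assms, of p, symmetric] by simp

definition info_density :: "'a pmf \<Rightarrow> ('a \<Rightarrow> 'b pmf) \<Rightarrow> 'a \<Rightarrow> 'b \<Rightarrow> real" where
  "info_density P K a b = log 2 (pmf (K a) b / pmf (bind_pmf P K) b)"

text \<open>On the support every letter probability is positive, so the logarithms split and the
  letterwise ratios multiply to one likelihood ratio of words. Converse and decoder analysis both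
  pass between letters and words through this identity.\<close>

lemma sum_info_density_words:
  fixes P :: "nat \<Rightarrow> 'x::finite pmf" and K :: "'x \<Rightarrow> 'y::finite pmf"
  assumes x: "\<And>i. i < n \<Longrightarrow> pmf (P i) (x i) > 0" and y: "y \<in> words n"
    and ne: "pmf (word_law n (\<lambda>i. K (x i))) y \<noteq> 0"
  shows "pmf (word_law n (\<lambda>i. bind_pmf (P i) K)) y > 0" (is "pmf ?q y > 0")
    and "(\<Sum>i<n. info_density (P i) K (x i) (y i)) =
      log 2 (pmf (word_law n (\<lambda>i. K (x i))) y) - log 2 (pmf (word_law n (\<lambda>i. bind_pmf (P i) K)) y)"
proof -
  have Kpos: "pmf (K (x i)) (y i) > 0" if "i < n" for i
    using ne that unfolding pmf_word_law[OF y] by (simp add: order_less_le)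
  have qpos: "pmf (bind_pmf (P i) K) (y i) > 0" if "i < n" for i
    by (rule pmf_bind_pos[of _ "x i" K, OF x[OF that] Kpos[OF that]])
  show "pmf ?q y > 0" unfolding pmf_word_law[OF y] using qpos by (intro prod_pos) auto
  have "(\<Sum>i<n. info_density (P i) K (x i) (y i)) =
      (\<Sum>i<n. log 2 (pmf (K (x i)) (y i)) - log 2 (pmf (bind_pmf (P i) K) (y i)))"
    unfolding info_density_def
  proof (intro sum.cong refl)
    fix i assume "i \<in> {..<n}"
    then show "log 2 (pmf (K (x i)) (y i) / pmf (bind_pmf (P i) K) (y i)) =
        log 2 (pmf (K (x i)) (y i)) - log 2 (pmf (bind_pmf (P i) K) (y i))"
      using Kpos[of i] qpos[of i] by (subst log_divide) auto
  qed
  also have "\<dots> = log 2 (pmf (word_law n (\<lambda>i. K (x i))) y) - log 2 (pmf ?q y)"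
  proof -
    have "log 2 (\<Prod>i<n. F i) = (\<Sum>i<n. log 2 (F i))" if "\<And>i. i < n \<Longrightarrow> F i > 0" for F :: "nat \<Rightarrow> real"
      unfolding log_def using that by (subst ln_prod) (auto simp: sum_divide_distrib less_imp_neq[symmetric])
    then show ?thesis unfolding pmf_word_law[OF y] sum_subtractf using Kpos qpos by simp
  qed
  finally show "(\<Sum>i<n. info_density (P i) K (x i) (y i)) =
      log 2 (pmf (word_law n (\<lambda>i. K (x i))) y) - log 2 (pmf ?q y)" .
qed

lemma chan_info_expectation:
  "chan_info P K = measure_pmf.expectation P (\<lambda>a. measure_pmf.expectation (K a) (info_density P K a))"
  unfolding chan_info_def info_density_def
  by (simp add: integral_measure_pmf[of UNIV] sum_distrib_left mult.assoc)

section \<open>Message sets and the error probability of a code\<close>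

lemma messages_finite: "finite (messages R n)" and messages_nonempty: "R \<ge> 0 \<Longrightarrow> messages R n \<noteq> {}"
  and card_messages: "card (messages R n) = nat \<lfloor>2 powr (real n * R)\<rfloor>"
proof -
  show "messages R n \<noteq> {}" if "R \<ge> 0"
  proof -
    have "2 powr (real n * R) \<ge> 1" using that by (simp add: ge_one_powr_ge_zero)
    then have "nat \<lfloor>2 powr (real n * R)\<rfloor> \<ge> 1" by (simp add: le_nat_floor nat_le_iff le_floor_iff)
    then show ?thesis by (simp add: messages_def)
  qed
qed (auto simp: messages_def)

text \<open>Discarding state and sensing output letter by letter commutes with the product, so the
  error probability sees the channel only through \<open>Wc\<close>.\<close>

lemma received_law:
  "map_pmf (received n) (block_law PS W n x) = word_law n (\<lambda>i. Wc PS W (x i))"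
proof -
  let ?p = "\<lambda>i. bind_pmf PS (\<lambda>s. map_pmf (\<lambda>(y, v). (s, y, v)) (W (x i) s))"
  have "word_law n (\<lambda>i. bind_pmf (?p i) (\<lambda>z. return_pmf (fst (snd z)))) =
    bind_pmf (block_law PS W n x) (\<lambda>f. Pi_pmf {..<n} undefined (\<lambda>i. return_pmf (fst (snd (f i)))))"
    unfolding word_law_def block_law_def by (rule Pi_pmf_bind) simp
  also have "\<dots> = map_pmf (received n) (block_law PS W n x)"
    by (simp add: map_pmf_def received_def[abs_def] restrict_def)
  also have "(\<lambda>i. bind_pmf (?p i) (\<lambda>z. return_pmf (fst (snd z)))) = (\<lambda>i. Wc PS W (x i))"
    by (simp add: Wc_def map_pmf_def[symmetric] map_bind_pmf pmf.map_comp o_def case_prod_unfold)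
  finally show ?thesis ..
qed

lemma error_prob_eq:
  fixes PS :: "'s::finite pmf" and W :: "'x::finite \<Rightarrow> 's \<Rightarrow> ('y::finite \<times> 'v::finite) pmf"
  assumes "R \<ge> 0"
  shows "error_prob PS W R n f \<phi> = (\<Sum>w\<in>messages R n.
    measure_pmf.prob (word_law n (\<lambda>i. Wc PS W (f w i))) {y. \<phi> y \<noteq> w}) / card (messages R n)"
proof -
  let ?A = "{(w, z). \<phi> (received n z) \<noteq> w}"
  note M = messages_finite messages_nonempty[OF assms]
  have fin: "finite (set_pmf (block_law PS W n x))" for x
    unfolding block_law_def word_law_def[symmetric] by (rule finite_set_word_law)
  have "error_prob PS W R n f \<phi> = measure_pmf.expectation (bind_pmf (pmf_of_set (messages R n))
          (\<lambda>w. map_pmf (\<lambda>z. (w, z)) (block_law PS W n (f w)))) (indicator ?A)"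
    unfolding error_prob_def by simp
  also have "\<dots> = (\<Sum>w\<in>messages R n. pmf (pmf_of_set (messages R n)) w *
      measure_pmf.expectation (map_pmf (\<lambda>z. (w, z)) (block_law PS W n (f w))) (indicator ?A))"
    using M fin by (subst pmf_expectation_bind[of "messages R n"]) auto
  also have "\<dots> = (\<Sum>w\<in>messages R n. measure_pmf.prob (word_law n (\<lambda>i. Wc PS W (f w i))) {y. \<phi> y \<noteq> w} / card (messages R n))"
  proof (intro sum.cong refl)
    fix w assume w: "w \<in> messages R n"
    have "measure_pmf.expectation (map_pmf (\<lambda>z. (w, z)) (block_law PS W n (f w))) (indicator ?A) =
       measure_pmf.prob (block_law PS W n (f w)) (received n -` {y. \<phi> y \<noteq> w})"
      by (simp add: vimage_def)
    also have "\<dots> = measure_pmf.prob (word_law n (\<lambda>i. Wc PS W (f w i))) {y. \<phi> y \<noteq> w}"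
      unfolding received_law[symmetric] by simp
    finally show "pmf (pmf_of_set (messages R n)) w *
      measure_pmf.expectation (map_pmf (\<lambda>z. (w, z)) (block_law PS W n (f w))) (indicator ?A) =
      measure_pmf.prob (word_law n (\<lambda>i. Wc PS W (f w i))) {y. \<phi> y \<noteq> w} / card (messages R n)"
      using w M by simp
  qed
  finally show ?thesis by (simp add: sum_divide_distrib)
qed

text \<open>The Donsker--Varadhan inequality for the joint law of message and output against the
  product of the output marginals, tested with the function that is \<open>card M\<close> where decoding
  succeeds and 1 elsewhere, replaces Fano's inequality and single-letterizes at once.\<close>

lemma code_converse:
  fixes K :: "'x::finite \<Rightarrow> 'y::finite pmf" and f :: "'w \<Rightarrow> nat \<Rightarrow> 'x"
    and \<phi> :: "(nat \<Rightarrow> 'y) \<Rightarrow> 'w" and n :: nat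
  assumes M: "finite M" "M \<noteq> {}"
  defines "P i \<equiv> map_pmf (\<lambda>w. f w i) (pmf_of_set M)"
  defines "Pe \<equiv> (\<Sum>w\<in>M. measure_pmf.prob (word_law n (\<lambda>i. K (f w i))) {y. \<phi> y \<noteq> w}) / card M"
  shows "(1 - Pe) * log 2 (card M) - 1 \<le> (\<Sum>i<n. chan_info (P i) K)"
proof -
  define m where "m = real (card M)"
  have m: "m \<ge> 1" using M by (simp add: m_def card_gt_0_iff Suc_le_eq)
  define q where "q = word_law n (\<lambda>i. bind_pmf (P i) K)"
  define \<mu> where "\<mu> w = word_law n (\<lambda>i. K (f w i))" for w
  define g where "g w y = (if \<phi> y = w then m else 1)" for w :: 'w and y
  define \<iota> where "\<iota> w y = (\<Sum>i<n. info_density (P i) K (f w i) (y i))" for w y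
  define E where "E w = measure_pmf.expectation (\<mu> w)" for w :: 'w and F :: "(nat \<Rightarrow> 'y) \<Rightarrow> real"
  have sum_words: "(\<Sum>y\<in>words n. pmf (word_law n p) y) = 1" for p :: "nat \<Rightarrow> 'y pmf"
    by (rule sum_pmf_eq_1[OF finite_words set_word_law])
  \<comment> \<open>The factor 1/2 normalises the test function: its sum over messages is at most
    2m, so the linearised remainder sums to at most zero. Its logarithm is the single bit lost in
    the conclusion.\<close>
  have pointwise: "pmf (\<mu> w) y * (log 2 (g w y) - \<iota> w y) \<le>
      pmf (\<mu> w) y + (g w y * pmf q y / 2 - pmf (\<mu> w) y) / ln 2" if w: "w \<in> M" and y: "y \<in> words n" for w y
  proof (cases "pmf (\<mu> w) y = 0")
    case True
    then show ?thesis using m by (simp add: g_def)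
  next
    case False
    have fpos: "pmf (P i) (f w i) > 0" for i using w M by (auto simp: P_def pmf_positive_iff)
    have qpos: "pmf q y > 0"
      unfolding q_def by (rule sum_info_density_words(1)[OF fpos y, of K]) (use False in \<open>simp add: \<mu>_def\<close>)
    have pos: "pmf (\<mu> w) y > 0" "pmf q y > 0" "g w y > 0"
      using False qpos m by (auto simp: g_def order_less_le)
    have "\<iota> w y = log 2 (pmf (\<mu> w) y) - log 2 (pmf q y)"
      unfolding \<iota>_def \<mu>_def q_def by (rule sum_info_density_words(2)[OF fpos y]) (use False in \<open>simp add: \<mu>_def\<close>)
    then have "log 2 (g w y) - \<iota> w y = 1 + log 2 (g w y * pmf q y / (2 * pmf (\<mu> w) y))"
      using pos by (simp add: log_divide log_mult)
    also have "\<dots> \<le> 1 + (g w y * pmf q y / (2 * pmf (\<mu> w) y) - 1) / ln 2"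
      using pos by (intro add_left_mono log2_le) auto
    finally have "pmf (\<mu> w) y * (log 2 (g w y) - \<iota> w y) \<le> pmf (\<mu> w) y * (1 + (g w y * pmf q y / (2 * pmf (\<mu> w) y) - 1) / ln 2)"
      using pos by (intro mult_left_mono) auto
    also have "\<dots> = pmf (\<mu> w) y + (g w y * pmf q y / 2 - pmf (\<mu> w) y) / ln 2"
      using pos by (simp add: field_simps)
    finally show ?thesis .
  qed
  have g_sum: "(\<Sum>w\<in>M. g w y) \<le> 2 * m" for y
  proof -
    have "(\<Sum>w\<in>M. g w y) \<le> (\<Sum>w\<in>M. 1 + (if w = \<phi> y then m else 0))"
      using m by (intro sum_mono) (auto simp: g_def)
    also have "\<dots> \<le> 2 * m" using M m by (auto simp: sum.distrib m_def)
    finally show ?thesis .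
  qed
  have succ: "(\<Sum>y\<in>words n. pmf (\<mu> w) y * log 2 (g w y)) = (1 - measure_pmf.prob (\<mu> w) {y. \<phi> y \<noteq> w}) * log 2 m" for w
  proof -
    have "(\<Sum>y\<in>words n. pmf (\<mu> w) y * log 2 (g w y)) = measure_pmf.expectation (\<mu> w) (\<lambda>y. indicator {y. \<phi> y = w} y * log 2 m)"
      unfolding \<mu>_def expectation_word_law by (intro sum.cong refl) (simp add: g_def indicator_def)
    also have "\<dots> = measure_pmf.prob (\<mu> w) {y. \<phi> y = w} * log 2 m" by simp
    also have "measure_pmf.prob (\<mu> w) {y. \<phi> y = w} = 1 - measure_pmf.prob (\<mu> w) {y. \<phi> y \<noteq> w}"
      using measure_pmf.prob_compl[of "{y. \<phi> y \<noteq> w}" "\<mu> w"] by (simp add: Compl_eq_Diff_UNIV[symmetric] Collect_neg_eq[symmetric])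
    finally show ?thesis .
  qed
  \<comment> \<open>Since the density is a sum over positions, each term sees one output letter, and
    the uniform average over messages turns the i-th letters of the codewords into the law
    \<open>P i\<close>.\<close>
  have info: "(\<Sum>w\<in>M. \<Sum>y\<in>words n. pmf (\<mu> w) y * \<iota> w y) = m * (\<Sum>i<n. chan_info (P i) K)"
  proof -
    have "(\<Sum>w\<in>M. \<Sum>y\<in>words n. pmf (\<mu> w) y * \<iota> w y) =
        (\<Sum>w\<in>M. \<Sum>i<n. \<Sum>y\<in>words n. pmf (\<mu> w) y * info_density (P i) K (f w i) (y i))"
      unfolding \<iota>_def sum_distrib_left by (intro sum.cong refl sum.swap)
    also have "\<dots> = (\<Sum>w\<in>M. \<Sum>i<n. measure_pmf.expectation (K (f w i)) (info_density (P i) K (f w i)))"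
      by (intro sum.cong refl)
         (simp add: \<mu>_def expectation_word_law[symmetric] expectation_word_law_component)
    also have "\<dots> = (\<Sum>i<n. m * measure_pmf.expectation (pmf_of_set M) (\<lambda>w. measure_pmf.expectation (K (f w i)) (info_density (P i) K (f w i))))"
      using M by (subst sum.swap) (simp add: integral_pmf_of_set m_def)
    also have "\<dots> = m * (\<Sum>i<n. chan_info (P i) K)"
      unfolding sum_distrib_left chan_info_expectation by (intro sum.cong refl) (simp add: P_def)
    finally show ?thesis .
  qed
  have "m * ((1 - Pe) * log 2 m) = (\<Sum>w\<in>M. (1 - measure_pmf.prob (\<mu> w) {y. \<phi> y \<noteq> w}) * log 2 m)"
    using m by (simp add: Pe_def \<mu>_def sum_subtractf sum_distrib_left m_def[symmetric] field_simps)
  then have "m * ((1 - Pe) * log 2 m) - m * (\<Sum>i<n. chan_info (P i) K) =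
      (\<Sum>w\<in>M. \<Sum>y\<in>words n. pmf (\<mu> w) y * (log 2 (g w y) - \<iota> w y))"
    unfolding right_diff_distrib sum_subtractf info succ by simp
  also have "\<dots> \<le> (\<Sum>w\<in>M. \<Sum>y\<in>words n. pmf (\<mu> w) y + (g w y * pmf q y / 2 - pmf (\<mu> w) y) / ln 2)"
    by (intro sum_mono pointwise)
  also have "\<dots> = m + ((\<Sum>y\<in>words n. (\<Sum>w\<in>M. g w y) * pmf q y / 2) - m) / ln 2"
  proof -
    have 1: "(\<Sum>w\<in>M. \<Sum>y\<in>words n. pmf (\<mu> w) y) = m" by (simp add: \<mu>_def sum_words m_def)
    have 2: "(\<Sum>w\<in>M. \<Sum>y\<in>words n. g w y * pmf q y / 2) = (\<Sum>y\<in>words n. (\<Sum>w\<in>M. g w y) * pmf q y / 2)"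
      by (subst sum.swap) (simp add: sum_distrib_right sum_divide_distrib)
    show ?thesis
      unfolding sum.distrib sum_divide_distrib[symmetric] sum_subtractf 1
      using 2 by (simp add: sum_divide_distrib)
  qed
  also have "\<dots> \<le> m + ((\<Sum>y\<in>words n. (2 * m) * pmf q y / 2) - m) / ln 2"
    by (intro add_left_mono divide_right_mono diff_right_mono sum_mono mult_right_mono g_sum) auto
  also have "\<dots> = m" by (simp add: sum_distrib_left[symmetric] q_def sum_words)
  finally have "m * ((1 - Pe) * log 2 m - (\<Sum>i<n. chan_info (P i) K) - 1) \<le> 0"
    by (simp add: algebra_simps)
  then show ?thesis using m by (simp add: m_def[symmetric] mult_le_0_iff)
qed

section \<open>Random coding\<close>

lemma prob_bind_pmf:
  assumes "finite (set_pmf P)" "\<And>x. finite (set_pmf (K x))"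
  shows "measure_pmf.prob (bind_pmf P K) A = measure_pmf.expectation P (\<lambda>x. measure_pmf.prob (K x) A)"
proof -
  have "measure_pmf.prob (bind_pmf P K) A = measure_pmf.expectation (bind_pmf P K) (indicator A)" by simp
  also have "\<dots> = (\<Sum>x\<in>set_pmf P. pmf P x *\<^sub>R measure_pmf.expectation (K x) (indicator A))"
    using assms by (intro pmf_expectation_bind) auto
  also have "\<dots> = measure_pmf.expectation P (\<lambda>x. measure_pmf.prob (K x) A)"
    using assms by (subst integral_measure_pmf[of "set_pmf P"]) auto
  finally show ?thesis .
qed

text \<open>Codewords of distinct messages are independent; the union bound below uses exactly this
  pairwise statement.\<close>

lemma Pi_pmf_two_components:
  assumes "finite M" "w \<in> M" "w' \<in> M" "w \<noteq> w'"
  shows "map_pmf (\<lambda>c. (c w, c w')) (Pi_pmf M d p) = pair_pmf (p w) (p w')"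
proof -
  define M' where "M' = M - {w}"
  have M': "M = insert w M'" "w \<notin> M'" "w' \<in> M'" "finite M'" using assms by (auto simp: M'_def)
  have "map_pmf (\<lambda>c. (c w, c w')) (Pi_pmf M d p) =
      map_pmf (\<lambda>z. (fst z, snd z w')) (pair_pmf (p w) (Pi_pmf M' d p))"
    unfolding M'(1) using M' assms(4)
    by (subst Pi_pmf_insert) (auto simp: pmf.map_comp o_def case_prod_unfold)
  also have "\<dots> = pair_pmf (p w) (map_pmf (\<lambda>c. c w') (Pi_pmf M' d p))"
    by (simp add: pair_pmf_def map_bind_pmf bind_map_pmf map_pmf_def bind_assoc_pmf bind_return_pmf)
  also have "map_pmf (\<lambda>c. c w') (Pi_pmf M' d p) = p w'"
    using M' by (subst Pi_pmf_component) auto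
  finally show ?thesis .
qed

text \<open>G is the acceptance test for pairs of codeword and output. \<open>Min M\<close> is a
  fallback that keeps the decoder inside M when no codeword or several codewords pass.\<close>

definition decode :: "nat set \<Rightarrow> ('a \<times> 'b) set \<Rightarrow> (nat \<Rightarrow> 'a) \<Rightarrow> 'b \<Rightarrow> nat" where
  "decode M G c y =
     (if \<exists>!w. w \<in> M \<and> (c w, y) \<in> G then THE w. w \<in> M \<and> (c w, y) \<in> G else Min M)"

lemma decode_in: "finite M \<Longrightarrow> M \<noteq> {} \<Longrightarrow> decode M G c y \<in> M"
  unfolding decode_def using theI'[of "\<lambda>w. w \<in> M \<and> (c w, y) \<in> G"] by auto

lemma decode_eq:
  assumes "w \<in> M" "(c w, y) \<in> G" "\<And>w'. w' \<in> M \<Longrightarrow> w' \<noteq> w \<Longrightarrow> (c w', y) \<notin> G"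
  shows "decode M G c y = w"
proof -
  have "\<exists>!w. w \<in> M \<and> (c w, y) \<in> G" using assms by blast
  moreover have "(THE w. w \<in> M \<and> (c w, y) \<in> G) = w" using assms by (intro the_equality) auto
  ultimately show ?thesis by (simp add: decode_def)
qed

text \<open>An error means that the sent codeword fails the test or a competitor passes it. A
  competitor is independent of the sent codeword, so against it the output has the averaged law
  \<open>bind_pmf P K\<close>, and \<delta> bounds each of the at most \<open>card M\<close>
  terms.\<close>

lemma random_coding:
  fixes P :: "'a pmf" and K :: "'a \<Rightarrow> 'b pmf" and \<alpha> \<delta> :: real
  assumes M: "finite M" "M \<noteq> {}"
    and fin: "finite (set_pmf P)" "\<And>x. finite (set_pmf (K x))"
    and \<alpha>: "measure_pmf.expectation P (\<lambda>x. measure_pmf.prob (K x) {y. (x, y) \<notin> G}) \<le> \<alpha>"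
    and \<delta>: "\<And>x. x \<in> set_pmf P \<Longrightarrow> measure_pmf.prob (bind_pmf P K) {y. (x, y) \<in> G} \<le> \<delta>" "\<delta> \<ge> 0"
  shows "measure_pmf.expectation (Pi_pmf M d (\<lambda>_. P))
     (\<lambda>c. (\<Sum>w\<in>M. measure_pmf.prob (K (c w)) {y. decode M G c y \<noteq> w}) / card M) \<le> \<alpha> + card M * \<delta>"
proof -
  let ?B = "Pi_pmf M d (\<lambda>_. P)"
  have finB: "finite (set_pmf ?B)"
    using M fin by (subst set_Pi_pmf) (auto intro!: finite_PiE_dflt)
  have int: "integrable (measure_pmf ?B) F" for F :: "_ \<Rightarrow> real"
    by (rule integrable_measure_pmf_finite[OF finB])
  have intP: "integrable (measure_pmf P) F" for F :: "_ \<Rightarrow> real"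
    by (rule integrable_measure_pmf_finite[OF fin(1)])
  have union: "measure_pmf.prob (K (c w)) {y. decode M G c y \<noteq> w} \<le>
     measure_pmf.prob (K (c w)) {y. (c w, y) \<notin> G} +
       (\<Sum>w'\<in>M - {w}. measure_pmf.prob (K (c w)) {y. (c w', y) \<in> G})" if "w \<in> M" for c w
  proof -
    have "{y. decode M G c y \<noteq> w} \<subseteq> {y. (c w, y) \<notin> G} \<union> (\<Union>w'\<in>M - {w}. {y. (c w', y) \<in> G})"
      using decode_eq[OF that, of c _ G] by auto
    then have "measure_pmf.prob (K (c w)) {y. decode M G c y \<noteq> w} \<le>
       measure_pmf.prob (K (c w)) ({y. (c w, y) \<notin> G} \<union> (\<Union>w'\<in>M - {w}. {y. (c w', y) \<in> G}))"
      by (intro measure_pmf.finite_measure_mono) auto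
    also have "\<dots> \<le> measure_pmf.prob (K (c w)) {y. (c w, y) \<notin> G} +
        measure_pmf.prob (K (c w)) (\<Union>w'\<in>M - {w}. {y. (c w', y) \<in> G})"
      by (intro measure_subadditive) auto
    also have "measure_pmf.prob (K (c w)) (\<Union>w'\<in>M - {w}. {y. (c w', y) \<in> G}) \<le>
        (\<Sum>w'\<in>M - {w}. measure_pmf.prob (K (c w)) {y. (c w', y) \<in> G})"
      using M by (intro measure_pmf.finite_measure_subadditive_finite) auto
    finally show ?thesis by simp
  qed
  have miss: "measure_pmf.expectation ?B (\<lambda>c. measure_pmf.prob (K (c w)) {y. (c w, y) \<notin> G}) \<le> \<alpha>" if "w \<in> M" for w
  proof -
    have "measure_pmf.expectation ?B (\<lambda>c. measure_pmf.prob (K (c w)) {y. (c w, y) \<notin> G}) =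
        measure_pmf.expectation (map_pmf (\<lambda>c. c w) ?B) (\<lambda>x. measure_pmf.prob (K x) {y. (x, y) \<notin> G})"
      by simp
    also have "map_pmf (\<lambda>c. c w) ?B = P" using M that by (subst Pi_pmf_component) auto
    finally show ?thesis using \<alpha> by simp
  qed
  have confuse: "measure_pmf.expectation ?B (\<lambda>c. measure_pmf.prob (K (c w)) {y. (c w', y) \<in> G}) \<le> \<delta>"
    if "w \<in> M" "w' \<in> M" "w' \<noteq> w" for w w'
  proof -
    let ?F = "\<lambda>z. measure_pmf.prob (K (snd z)) {y. (fst z, y) \<in> G}"
    have "measure_pmf.expectation ?B (\<lambda>c. measure_pmf.prob (K (c w)) {y. (c w', y) \<in> G}) =
       measure_pmf.expectation (map_pmf (\<lambda>c. (c w', c w)) ?B) ?F" by simp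
    also have "\<dots> = measure_pmf.expectation (bind_pmf P (\<lambda>x'. map_pmf (Pair x') P)) ?F"
      unfolding Pi_pmf_two_components[OF M(1) that(2,1,3)] by (simp add: pair_pmf_def map_pmf_def)
    also have "\<dots> = (\<Sum>x'\<in>set_pmf P. pmf P x' * measure_pmf.expectation P (\<lambda>x. measure_pmf.prob (K x) {y. (x', y) \<in> G}))"
      using fin by (subst pmf_expectation_bind[of "set_pmf P"]) auto
    also have "\<dots> = (\<Sum>x'\<in>set_pmf P. pmf P x' * measure_pmf.prob (bind_pmf P K) {y. (x', y) \<in> G})"
      by (simp add: prob_bind_pmf[OF fin])
    also have "\<dots> \<le> (\<Sum>x'\<in>set_pmf P. pmf P x' * \<delta>)"
      by (intro sum_mono mult_left_mono \<delta>) auto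
    also have "\<dots> = \<delta>" using fin by (simp add: sum_distrib_right[symmetric] sum_pmf_eq_1)
    finally show ?thesis .
  qed
  have "measure_pmf.expectation ?B (\<lambda>c. (\<Sum>w\<in>M. measure_pmf.prob (K (c w)) {y. decode M G c y \<noteq> w}) / card M) =
     (\<Sum>w\<in>M. measure_pmf.expectation ?B (\<lambda>c. measure_pmf.prob (K (c w)) {y. decode M G c y \<noteq> w})) / card M"
    by (simp add: int)
  also have "\<dots> \<le> (\<Sum>w\<in>M. \<alpha> + card M * \<delta>) / card M"
  proof (intro divide_right_mono sum_mono)
    fix w assume w: "w \<in> M"
    have "measure_pmf.expectation ?B (\<lambda>c. measure_pmf.prob (K (c w)) {y. decode M G c y \<noteq> w}) \<le>
      measure_pmf.expectation ?B (\<lambda>c. measure_pmf.prob (K (c w)) {y. (c w, y) \<notin> G} +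
       (\<Sum>w'\<in>M - {w}. measure_pmf.prob (K (c w)) {y. (c w', y) \<in> G}))"
      using union[OF w] by (intro integral_mono int) auto
    also have "\<dots> = measure_pmf.expectation ?B (\<lambda>c. measure_pmf.prob (K (c w)) {y. (c w, y) \<notin> G}) +
       (\<Sum>w'\<in>M - {w}. measure_pmf.expectation ?B (\<lambda>c. measure_pmf.prob (K (c w)) {y. (c w', y) \<in> G}))"
      by (simp add: int)
    also have "\<dots> \<le> \<alpha> + (\<Sum>w'\<in>M - {w}. \<delta>)"
      using w by (intro add_mono miss sum_mono confuse) auto
    also have "\<dots> \<le> \<alpha> + card M * \<delta>"
      using \<delta>(2) by (auto intro!: mult_right_mono card_mono M)
    finally show "measure_pmf.expectation ?B (\<lambda>c. measure_pmf.prob (K (c w)) {y. decode M G c y \<noteq> w}) \<le> \<alpha> + card M * \<delta>" .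
  qed auto
  also have "\<dots> = \<alpha> + card M * \<delta>" using M by simp
  finally show ?thesis .
qed

lemma word_law_bind:
  "word_law n (\<lambda>i. bind_pmf (P i) (K i)) = bind_pmf (word_law n P) (\<lambda>x. word_law n (\<lambda>i. K i (x i)))"
  unfolding word_law_def by (rule Pi_pmf_bind) simp

text \<open>Change of measure: on the set in question q is below p / t pointwise, and p has total
  mass 1.\<close>

lemma prob_likelihood_ratio:
  fixes p q :: "'a pmf"
  assumes fin: "finite (set_pmf q)" and t: "t > 0"
  shows "measure_pmf.prob q {y. pmf p y > t * pmf q y} \<le> 1 / t"
proof -
  let ?S = "set_pmf q \<inter> {y. pmf p y > t * pmf q y}"
  have "measure_pmf.prob q {y. pmf p y > t * pmf q y} = measure_pmf.prob q ?S"
    by (rule measure_pmf.finite_measure_eq_AE) (auto simp: AE_measure_pmf_iff)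
  also have "\<dots> = (\<Sum>y\<in>?S. pmf q y)" using fin by (intro measure_measure_pmf_finite) auto
  also have "\<dots> \<le> (\<Sum>y\<in>?S. pmf p y / t)" using t by (intro sum_mono) (auto simp: field_simps)
  also have "\<dots> = measure_pmf.prob p ?S / t"
    using fin by (subst measure_measure_pmf_finite) (auto simp: sum_divide_distrib)
  also have "\<dots> \<le> 1 / t" using t by (intro divide_right_mono) auto
  finally show ?thesis .
qed

text \<open>Hoeffding's inequality for independent summands in an interval of length 2B: the
  exponent 2(n\<gamma>)^2 / (n(2B)^2) simplifies to the one stated.\<close>

lemma info_density_tail:
  fixes P :: "nat \<Rightarrow> 'x::finite pmf" and K :: "'x \<Rightarrow> 'y::finite pmf"
  assumes B: "\<And>i x y. i < n \<Longrightarrow> \<bar>info_density (P i) K x y\<bar> \<le> B" "B > 0" and n: "n > 0" and \<gamma>: "\<gamma> \<ge> 0"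
  defines "J \<equiv> word_law n (\<lambda>i. bind_pmf (P i) (\<lambda>x. map_pmf (Pair x) (K x)))"
  shows "measure_pmf.prob J {z. (\<Sum>i<n. case_prod (info_density (P i) K) (z i)) \<le>
      (\<Sum>i<n. chan_info (P i) K) - real n * \<gamma>} \<le> exp (- (real n * \<gamma>\<^sup>2 / (2 * B\<^sup>2)))"
proof -
  let ?X = "\<lambda>i z. case_prod (info_density (P i) K) (z i)"
  interpret Hoeffding_ineq "measure_pmf J" "{..<n}" ?X "\<lambda>_. - B" "\<lambda>_. B"
    "\<Sum>i<n. measure_pmf.expectation J (?X i)"
  proof unfold_locales
    have "prob_space.indep_vars (measure_pmf J) (\<lambda>_. count_space UNIV) (\<lambda>i z. z i) {..<n}"
      unfolding J_def word_law_def by (rule indep_vars_Pi_pmf) simp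
    then show "prob_space.indep_vars (measure_pmf J) (\<lambda>_. borel) ?X {..<n}"
      by (rule prob_space.indep_vars_compose2[OF prob_space_measure_pmf]) auto
    show "AE z in measure_pmf J. ?X i z \<in> {- B..B}" if "i \<in> {..<n}" for i
      using B(1)[of i] that by (auto simp: abs_le_iff case_prod_unfold minus_le_iff)
  qed auto
  have E: "measure_pmf.expectation J (?X i) = chan_info (P i) K" if "i < n" for i
  proof -
    have "measure_pmf.expectation J (?X i) =
       measure_pmf.expectation (bind_pmf (P i) (\<lambda>x. map_pmf (Pair x) (K x))) (case_prod (info_density (P i) K))"
      unfolding J_def using that by (rule expectation_word_law_component)
    also have "\<dots> = chan_info (P i) K"
      by (subst pmf_expectation_bind[of UNIV]) (auto simp: chan_info_expectation integral_measure_pmf[of UNIV])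
    finally show ?thesis .
  qed
  have "(\<Sum>i<n. (B - - B)\<^sup>2) = real n * (4 * B\<^sup>2)" by (simp add: power2_eq_square)
  moreover have "real n * (4 * B\<^sup>2) > 0" using n B by simp
  ultimately have "measure_pmf.prob J {z \<in> space (measure_pmf J). (\<Sum>i<n. ?X i z) \<le> (\<Sum>i<n. measure_pmf.expectation J (?X i)) - real n * \<gamma>} \<le>
     exp (-2 * (real n * \<gamma>)\<^sup>2 / (real n * (4 * B\<^sup>2)))"
    using Hoeffding_ineq_le[of "real n * \<gamma>"] \<gamma> by simp
  also have "-2 * (real n * \<gamma>)\<^sup>2 / (real n * (4 * B\<^sup>2)) = - (real n * \<gamma>\<^sup>2 / (2 * B\<^sup>2))"
    using n B by (simp add: field_simps power2_eq_square)
  finally show ?thesis using E by simp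
qed

text \<open>The test compares the likelihood ratio of words with 2 to the power a, where a lies
  n\<gamma> below the mean S of the information density. Rejecting the sent word is then the lower
  tail, and accepting a wrong one has probability at most 2 to the power -a by change of
  measure.\<close>

lemma word_random_coding:
  fixes P :: "nat \<Rightarrow> 'x::finite pmf" and K :: "'x \<Rightarrow> 'y::finite pmf"
  assumes B: "\<And>i x y. i < n \<Longrightarrow> \<bar>info_density (P i) K x y\<bar> \<le> B" "B > 0" and n: "n > 0" and \<gamma>: "\<gamma> \<ge> 0"
    and M: "finite M" "M \<noteq> {}"
  defines "S \<equiv> (\<Sum>i<n. chan_info (P i) K)"
  obtains G where "measure_pmf.expectation (Pi_pmf M d (\<lambda>_. word_law n P))
     (\<lambda>c. (\<Sum>w\<in>M. measure_pmf.prob (word_law n (\<lambda>i. K (c w i))) {y. decode M G c y \<noteq> w}) / card M)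
     \<le> exp (- (real n * \<gamma>\<^sup>2 / (2 * B\<^sup>2))) + card M / 2 powr (S - real n * \<gamma>)"
proof -
  define a where "a = S - real n * \<gamma>"
  define Kn where "Kn x = word_law n (\<lambda>i. K (x i))" for x
  define Q where "Q = word_law n (\<lambda>i. bind_pmf (P i) K)"
  define G where "G = {(x, y). pmf (Kn x) y > 2 powr a * pmf Q y}"
  have Q: "bind_pmf (word_law n P) Kn = Q" unfolding Q_def Kn_def by (rule word_law_bind[symmetric])
  have fin: "finite (set_pmf (word_law n P))" "finite (set_pmf (Kn x))" "finite (set_pmf Q)" for x
    unfolding Kn_def Q_def by (rule finite_set_word_law)+
  let ?A = "{z. (\<Sum>i<n. case_prod (info_density (P i) K) (z i)) \<le> a}"
  have "measure_pmf.expectation (word_law n P) (\<lambda>x. measure_pmf.prob (Kn x) {y. (x, y) \<notin> G}) \<le>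
      measure_pmf.expectation (word_law n P) (\<lambda>x. measure_pmf.prob (word_law n (\<lambda>i. map_pmf (Pair (x i)) (K (x i)))) ?A)"
  proof (intro integral_mono_AE integrable_measure_pmf_finite fin AE_pmfI)
    fix x assume x: "x \<in> set_pmf (word_law n P)"
    have xpos: "pmf (P i) (x i) > 0" if "i < n" for i
      using x that unfolding word_law_def by (auto simp: set_Pi_pmf PiE_dflt_def pmf_positive)
    have "word_law n (\<lambda>i. bind_pmf (K (x i)) (\<lambda>y. return_pmf (x i, y))) =
      bind_pmf (Kn x) (\<lambda>y. word_law n (\<lambda>i. return_pmf (x i, y i)))"
      unfolding Kn_def by (rule word_law_bind)
    \<comment> \<open>For a fixed codeword the law of letter pairs is an image of the output law, so
      the tail event for pairs becomes an event about y alone.\<close>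
    then have "word_law n (\<lambda>i. map_pmf (Pair (x i)) (K (x i))) = map_pmf (\<lambda>y. \<lambda>i\<in>{..<n}. (x i, y i)) (Kn x)"
      by (simp add: map_pmf_def word_law_def restrict_def)
    then have "measure_pmf.prob (word_law n (\<lambda>i. map_pmf (Pair (x i)) (K (x i)))) ?A =
        measure_pmf.prob (Kn x) {y. (\<Sum>i<n. info_density (P i) K (x i) (y i)) \<le> a}"
      by (simp add: vimage_def)
    moreover have "measure_pmf.prob (Kn x) {y. (x, y) \<notin> G} \<le> measure_pmf.prob (Kn x) {y. (\<Sum>i<n. info_density (P i) K (x i) (y i)) \<le> a}"
    proof (rule measure_pmf.finite_measure_mono_AE; (intro AE_pmfI impI)?)
      fix y assume y: "y \<in> set_pmf (Kn x)" and yG: "y \<in> {y. (x, y) \<notin> G}"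
      have yw: "y \<in> words n" using y set_word_law unfolding Kn_def by blast
      have pos: "pmf (Kn x) y > 0" using y by (rule pmf_positive)
      note d = sum_info_density_words[where P = P and x = x and n = n and K = K, OF xpos yw, folded Kn_def Q_def]
      have q: "pmf Q y > 0" using d(1) pos by auto
      have "pmf (Kn x) y \<le> 2 powr a * pmf Q y" using yG by (simp add: G_def)
      then have "log 2 (pmf (Kn x) y) \<le> log 2 (2 powr a * pmf Q y)" using pos q by simp
      also have "\<dots> = a + log 2 (pmf Q y)" using q by (simp add: log_mult)
      finally show "y \<in> {y. (\<Sum>i<n. info_density (P i) K (x i) (y i)) \<le> a}" using d(2) pos by simp
    qed auto
    ultimately show "measure_pmf.prob (Kn x) {y. (x, y) \<notin> G} \<le>
        measure_pmf.prob (word_law n (\<lambda>i. map_pmf (Pair (x i)) (K (x i)))) ?A" by simp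
  qed
  also have "\<dots> = measure_pmf.prob (word_law n (\<lambda>i. bind_pmf (P i) (\<lambda>x. map_pmf (Pair x) (K x)))) ?A"
    unfolding word_law_bind by (rule prob_bind_pmf[symmetric]) (auto intro: finite_set_word_law)
  also have "\<dots> \<le> exp (- (real n * \<gamma>\<^sup>2 / (2 * B\<^sup>2)))"
    unfolding a_def S_def by (rule info_density_tail[OF B n \<gamma>])
  finally have miss: "measure_pmf.expectation (word_law n P) (\<lambda>x. measure_pmf.prob (Kn x) {y. (x, y) \<notin> G})
     \<le> exp (- (real n * \<gamma>\<^sup>2 / (2 * B\<^sup>2)))" .
  have "measure_pmf.prob (bind_pmf (word_law n P) Kn) {y. (x, y) \<in> G} \<le> 1 / 2 powr a" for x
    unfolding Q G_def using prob_likelihood_ratio[OF fin(3), of "2 powr a" "Kn x"] by simp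
  with random_coding[OF M fin(1,2) miss, of "1 / 2 powr a" d] show thesis
    by (intro that[of G]) (simp add: Kn_def[abs_def] a_def)
qed

lemma pmf_exists_ge_expectation:
  fixes F :: "'a \<Rightarrow> real"
  assumes "finite (set_pmf p)" "v \<le> measure_pmf.expectation p F"
  obtains c where "c \<in> set_pmf p" "v \<le> F c"
proof -
  obtain c where c: "c \<in> set_pmf p" "\<forall>d\<in>set_pmf p. F d \<le> F c"
    using assms(1) set_pmf_not_empty[of p] obtains_MAX[of "set_pmf p" F] by (metis Max_ge finite_imageI imageI)
  have "measure_pmf.expectation p F \<le> measure_pmf.expectation p (\<lambda>_. F c)"
    using c by (intro integral_mono_AE integrable_measure_pmf_finite assms(1) AE_pmfI) auto
  with assms(2) c(1) show thesis by (intro that[of c]) auto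
qed

section \<open>From random codebooks to achievable pairs\<close>

context
  fixes PS :: "'s::finite pmf" and W :: "'x::finite \<Rightarrow> 's \<Rightarrow> ('y::finite \<times> 'v::finite) pmf"
begin

text \<open>Sensing level and weighted error are combined into one functional of the codebook, so a
  single comparison with the mean controls both. Two separate comparisons could pick different
  codebooks.\<close>

lemma code_exists:
  fixes P :: "nat \<Rightarrow> 'x pmf" and dec :: "(nat \<Rightarrow> nat \<Rightarrow> 'x) \<Rightarrow> (nat \<Rightarrow> 'y) \<Rightarrow> nat"
  assumes R: "R \<ge> 0" and \<kappa>: "\<kappa> \<ge> 0"
    and dec: "\<And>c y. dec c y \<in> messages R n"
    and \<delta>: "measure_pmf.expectation (Pi_pmf (messages R n) undefined (\<lambda>_. word_law n P))
       (\<lambda>c. (\<Sum>w\<in>messages R n. measure_pmf.prob (word_law n (\<lambda>i. Wc PS W (c w i))) {y. dec c y \<noteq> w}) /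
          card (messages R n)) \<le> \<delta>"
  obtains f \<phi> where "is_code R n f \<phi>"
    "code_sensing PS W R n f - \<kappa> * error_prob PS W R n f \<phi> \<ge>
       1 / real n * (\<Sum>i<n. sensing PS W (P i)) - \<kappa> * \<delta>"
proof -
  let ?M = "messages R n"
  let ?B = "Pi_pmf ?M undefined (\<lambda>_. word_law n P)"
  note M = messages_finite messages_nonempty[OF R]
  have finB: "finite (set_pmf ?B)"
    using M finite_set_word_law[of n P] by (subst set_Pi_pmf) (auto intro!: finite_PiE_dflt)
  have int: "integrable (measure_pmf ?B) F" for F :: "_ \<Rightarrow> real"
    by (rule integrable_measure_pmf_finite[OF finB])
  \<comment> \<open>For each message the i-th letter of its random codeword has law
    \<open>P i\<close>, hence so does the mixture over messages. The empirical marginal thus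
    averages to the design law.\<close>
  have marg: "bind_pmf ?B (\<lambda>c. input_marginal R n c i) = P i" if "i < n" for i
  proof -
    have "bind_pmf ?B (\<lambda>c. input_marginal R n c i) =
        bind_pmf (pmf_of_set ?M) (\<lambda>w. map_pmf (\<lambda>c. c w i) ?B)"
      unfolding input_marginal_def map_pmf_def by (rule bind_commute_pmf)
    also have "\<dots> = bind_pmf (pmf_of_set ?M) (\<lambda>w. P i)"
    proof (intro bind_pmf_cong refl)
      fix w assume "w \<in> set_pmf (pmf_of_set ?M)"
      then have w: "w \<in> ?M" using M by simp
      have "map_pmf (\<lambda>c. c w i) ?B = map_pmf (\<lambda>x. x i) (map_pmf (\<lambda>c. c w) ?B)"
        by (simp add: pmf.map_comp o_def)
      also have "map_pmf (\<lambda>c. c w) ?B = word_law n P" using M w by (subst Pi_pmf_component) auto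
      finally show "map_pmf (\<lambda>c. c w i) ?B = P i" by (simp add: word_law_component[OF that])
    qed
    finally show ?thesis by simp
  qed
  have "1 / real n * (\<Sum>i<n. sensing PS W (P i)) \<le>
      1 / real n * (\<Sum>i<n. measure_pmf.expectation ?B (\<lambda>c. sensing PS W (input_marginal R n c i)))"
  proof (intro mult_left_mono sum_mono)
    fix i assume "i \<in> {..<n}"
    then show "sensing PS W (P i) \<le> measure_pmf.expectation ?B (\<lambda>c. sensing PS W (input_marginal R n c i))"
      using sensing_convex[OF finB, of PS W "\<lambda>c. input_marginal R n c i"] marg by simp
  qed simp
  also have "\<dots> = measure_pmf.expectation ?B (code_sensing PS W R n)"
    unfolding code_sensing_def[abs_def] by (simp add: int)
  finally have sens: "1 / real n * (\<Sum>i<n. sensing PS W (P i)) \<le> measure_pmf.expectation ?B (code_sensing PS W R n)" .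
  have err: "measure_pmf.expectation ?B (\<lambda>c. error_prob PS W R n c (dec c)) \<le> \<delta>"
    unfolding error_prob_eq[OF R] by (rule \<delta>)
  have "1 / real n * (\<Sum>i<n. sensing PS W (P i)) - \<kappa> * \<delta> \<le>
      measure_pmf.expectation ?B (code_sensing PS W R n) -
        \<kappa> * measure_pmf.expectation ?B (\<lambda>c. error_prob PS W R n c (dec c))"
    using sens mult_left_mono[OF err \<kappa>] by linarith
  also have "\<dots> = measure_pmf.expectation ?B (\<lambda>c. code_sensing PS W R n c - \<kappa> * error_prob PS W R n c (dec c))"
    by (simp add: int)
  finally obtain c where c: "c \<in> set_pmf ?B"
    "1 / real n * (\<Sum>i<n. sensing PS W (P i)) - \<kappa> * \<delta> \<le> code_sensing PS W R n c - \<kappa> * error_prob PS W R n c (dec c)"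
    by (rule pmf_exists_ge_expectation[OF finB])
  have "c w \<in> {..<n} \<rightarrow>\<^sub>E UNIV" if "w \<in> ?M" for w
    using c(1) that set_word_law[of n P] M unfolding words_eq[symmetric]
    by (auto simp: set_Pi_pmf PiE_dflt_def)
  then have "is_code R n c (dec c)" unfolding is_code_def using dec by blast
  then show thesis using c(2) by (rule that)
qed

lemma sensing_nonneg: "sensing PS W P \<ge> 0"
  unfolding sensing_eq by (rule chan_info_nonneg)

lemma sensing_bounded: obtains b where "b \<ge> 0" "\<And>P. sensing PS W P \<le> b"
proof -
  have "bounded (snd ` single_mode_points PS W)"
    by (intro compact_imp_bounded compact_continuous_image compact_single_mode_points continuous_intros)
  then obtain b where b: "\<And>P. \<bar>sensing PS W P\<bar> \<le> b"
    unfolding bounded_iff single_mode_points_def by auto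
  show thesis
  proof (rule that)
    show "b \<ge> 0" using b[of undefined] by linarith
    show "sensing PS W P \<le> b" for P using b[of P] by linarith
  qed
qed

text \<open>Selecting the codebook that maximises the sensing level minus the error probability weighted
  by $1 / \sqrt{\delta_n}$ meets both requirements at once.\<close>

lemma achievable_if_expected_error:
  fixes P :: "nat \<Rightarrow> nat \<Rightarrow> 'x pmf" and dec :: "nat \<Rightarrow> (nat \<Rightarrow> nat \<Rightarrow> 'x) \<Rightarrow> (nat \<Rightarrow> 'y) \<Rightarrow> nat"
  assumes R: "R \<ge> 0" and D: "0 \<le> D" "D \<le> D'"
    and dec: "\<And>n c y. dec n c y \<in> messages R n"
    and \<delta>: "\<And>n. measure_pmf.expectation (Pi_pmf (messages R n) undefined (\<lambda>_. word_law n (P n)))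
       (\<lambda>c. (\<Sum>w\<in>messages R n. measure_pmf.prob (word_law n (\<lambda>i. Wc PS W (c w i))) {y. dec n c y \<noteq> w}) /
          card (messages R n)) \<le> \<delta> n"
    and \<delta>0: "\<delta> \<longlonglongrightarrow> 0" "\<And>n. \<delta> n \<ge> 0"
    and sens: "(\<lambda>n. 1 / real n * (\<Sum>i<n. sensing PS W (P n i))) \<longlonglongrightarrow> D'"
  shows "(R, D) \<in> achievable_pairs PS W"
proof -
  \<comment> \<open>The added 1 / (n + 1) keeps \<eta> positive when \<delta> n is zero, so that the
    weight 1 / \<eta> is genuine.\<close>
  define \<eta> where "\<eta> n = sqrt (\<delta> n + 1 / real (Suc n))" for n
  have \<eta>pos: "\<eta> n > 0" for n unfolding \<eta>_def using \<delta>0(2)[of n] by (simp add: add_nonneg_pos)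
  have \<eta>sq: "\<delta> n \<le> \<eta> n * \<eta> n" for n
    unfolding \<eta>_def using \<delta>0(2)[of n] by (simp add: real_sqrt_mult_self)
  have "(\<lambda>n. \<delta> n + 1 / real (Suc n)) \<longlonglongrightarrow> 0 + 0"
    by (intro tendsto_add \<delta>0 LIMSEQ_Suc[OF lim_1_over_n])
  then have \<eta>0: "\<eta> \<longlonglongrightarrow> 0" unfolding \<eta>_def[abs_def] using tendsto_real_sqrt by fastforce
  define d where "d n = 1 / real n * (\<Sum>i<n. sensing PS W (P n i))" for n
  have d0: "d n \<ge> 0" for n unfolding d_def by (intro mult_nonneg_nonneg sum_nonneg sensing_nonneg) auto
  have "\<exists>f \<phi>. is_code R n f \<phi> \<and> code_sensing PS W R n f - (1 / \<eta> n) * error_prob PS W R n f \<phi> \<ge> d n - (1 / \<eta> n) * \<delta> n" for n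
    unfolding d_def by (rule code_exists[OF R _ dec \<delta>, of "1 / \<eta> n"]) (use \<eta>pos[of n] in auto)
  then obtain f \<phi> where code: "\<And>n. is_code R n (f n) (\<phi> n)" and
    bnd: "\<And>n. code_sensing PS W R n (f n) - (1 / \<eta> n) * error_prob PS W R n (f n) (\<phi> n) \<ge> d n - (1 / \<eta> n) * \<delta> n"
    by metis
  obtain b where b: "b \<ge> 0" "\<And>P. sensing PS W P \<le> b" by (rule sensing_bounded) blast
  have cs: "code_sensing PS W R n (f n) \<le> b" for n
  proof -
    have "code_sensing PS W R n (f n) \<le> 1 / real n * (\<Sum>i<n. b)"
      unfolding code_sensing_def by (intro mult_left_mono sum_mono b) auto
    also have "\<dots> \<le> b" using b by (cases "n = 0") auto
    finally show ?thesis .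
  qed
  have \<kappa>\<delta>: "(1 / \<eta> n) * \<delta> n \<le> \<eta> n" for n
    using \<eta>sq[of n] \<eta>pos[of n] by (simp add: divide_le_eq)
  have e0: "error_prob PS W R n (f n) (\<phi> n) \<ge> 0" for n unfolding error_prob_def by simp
  \<comment> \<open>The chosen code scores at least -\<eta>, while its sensing level is at most b;
    hence the weighted error is at most b + \<eta>, and multiplying by \<eta> sends it to
    zero.\<close>
  have "error_prob PS W R n (f n) (\<phi> n) \<le> \<eta> n * (b + \<eta> n)" for n
  proof -
    have "(1 / \<eta> n) * error_prob PS W R n (f n) (\<phi> n) \<le> b + \<eta> n"
      using bnd[of n] cs[of n] \<kappa>\<delta>[of n] d0[of n] by linarith
    then have "\<eta> n * ((1 / \<eta> n) * error_prob PS W R n (f n) (\<phi> n)) \<le> \<eta> n * (b + \<eta> n)"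
      using \<eta>pos[of n] by (intro mult_left_mono) auto
    then show ?thesis using \<eta>pos[of n] by simp
  qed
  then have le: "\<forall>\<^sub>F n in sequentially. error_prob PS W R n (f n) (\<phi> n) \<le> \<eta> n * (b + \<eta> n)" by simp
  have "(\<lambda>n. \<eta> n * (b + \<eta> n)) \<longlonglongrightarrow> 0 * (b + 0)" by (intro tendsto_intros \<eta>0)
  then have "(\<lambda>n. \<eta> n * (b + \<eta> n)) \<longlonglongrightarrow> 0" by simp
  from tendsto_sandwich[OF always_eventually[OF allI[OF e0]] le tendsto_const this]
  have "(\<lambda>n. error_prob PS W R n (f n) (\<phi> n)) \<longlonglongrightarrow> 0" .
  moreover have "ereal D \<le> liminf (\<lambda>n. ereal (code_sensing PS W R n (f n)))"
  proof -
    have "(\<lambda>n. d n - \<eta> n) \<longlonglongrightarrow> D' - 0" unfolding d_def by (intro tendsto_diff sens \<eta>0)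
    then have "(\<lambda>n. ereal (d n - \<eta> n)) \<longlonglongrightarrow> ereal D'" by simp
    then have "ereal D' = liminf (\<lambda>n. ereal (d n - \<eta> n))"
      by (intro lim_imp_Liminf[symmetric]) auto
    also have "\<dots> \<le> liminf (\<lambda>n. ereal (code_sensing PS W R n (f n)))"
    proof (intro Liminf_mono always_eventually allI)
      fix n
      have "(1 / \<eta> n) * error_prob PS W R n (f n) (\<phi> n) \<ge> 0" using e0[of n] \<eta>pos[of n] by simp
      then show "ereal (d n - \<eta> n) \<le> ereal (code_sensing PS W R n (f n))"
        using bnd[of n] \<kappa>\<delta>[of n] by simp
    qed
    finally show ?thesis using D(2) by (metis ereal_less_eq(3) order_trans)
  qed
  ultimately show ?thesis unfolding achievable_pairs_def using R D code by blast
qed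

text \<open>The switching position is within 1 of u n, so its fraction of the block tends to u. F
  stays generic because both the rate and the sensing level are averaged this way.\<close>

lemma time_sharing_average:
  fixes F :: "'x pmf \<Rightarrow> real"
  assumes u: "0 \<le> u" "u \<le> 1"
  shows "(\<lambda>n. 1 / real n * (\<Sum>i<n. F (if i < nat \<lfloor>u * real n\<rfloor> then P0 else P1))) \<longlonglongrightarrow> u * F P0 + (1 - u) * F P1"
proof -
  define k where "k n = nat \<lfloor>u * real n\<rfloor>" for n
  have kr: "real (k n) \<le> u * real n" "real (k n) > u * real n - 1" for n
    using u unfolding k_def by (simp_all add: of_nat_nat; linarith)+
  have kn: "k n \<le> n" for n
  proof -
    have "u * real n \<le> real n" using u by (simp add: mult_left_le_one_le)
    then show ?thesis using kr(1)[of n] by linarith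
  qed
  have k: "(\<lambda>n. real (k n) / real n) \<longlonglongrightarrow> u"
  proof (rule tendsto_sandwich)
    show "\<forall>\<^sub>F n in sequentially. u - 1 / real n \<le> real (k n) / real n"
      using eventually_gt_at_top[of 0]
    proof eventually_elim
      case (elim n)
      have "(u * real n - 1) / real n \<le> real (k n) / real n" using kr(2)[of n] by (intro divide_right_mono) auto
      then show ?case using elim by (simp add: field_simps)
    qed
    show "\<forall>\<^sub>F n in sequentially. real (k n) / real n \<le> u"
      using eventually_gt_at_top[of 0]
    proof eventually_elim
      case (elim n)
      then show ?case using kr(1)[of n] by (simp add: field_simps)
    qed
    show "(\<lambda>n. u - 1 / real n) \<longlonglongrightarrow> u" using tendsto_diff[OF tendsto_const lim_1_over_n, of u] by simp
  qed auto
  have eq: "1 / real n * (\<Sum>i<n. F (if i < k n then P0 else P1)) = real (k n) / real n * F P0 + (1 - real (k n) / real n) * F P1" if "n > 0" for n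
  proof -
    have "{..<n} = {..<k n} \<union> {k n..<n}" using kn[of n] by auto
    then have "(\<Sum>i<n. F (if i < k n then P0 else P1)) = (\<Sum>i<k n. F P0) + (\<Sum>i=k n..<n. F P1)"
      by (simp add: sum.union_disjoint ivl_disj_int)
    also have "\<dots> = real (k n) * F P0 + (real n - real (k n)) * F P1" using kn[of n] by (simp add: of_nat_diff)
    finally show ?thesis using that by (simp add: field_simps)
  qed
  have "(\<lambda>n. real (k n) / real n * F P0 + (1 - real (k n) / real n) * F P1) \<longlonglongrightarrow> u * F P0 + (1 - u) * F P1"
    by (intro tendsto_intros k)
  moreover have "\<forall>\<^sub>F n in sequentially. real (k n) / real n * F P0 + (1 - real (k n) / real n) * F P1 =
      1 / real n * (\<Sum>i<n. F (if i < k n then P0 else P1))"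
    using eventually_gt_at_top[of 0] by eventually_elim (rule eq[symmetric])
  ultimately show ?thesis unfolding k_def by (rule Lim_transform_eventually)
qed

text \<open>A single message is decoded without error, so at rate zero only the sensing level matters.\<close>

lemma achievable_rate_zero:
  assumes u: "0 \<le> u" "u \<le> 1" and D: "0 \<le> D" "D \<le> u * sensing PS W P0 + (1 - u) * sensing PS W P1"
  shows "(0, D) \<in> achievable_pairs PS W"
proof (rule achievable_if_expected_error[OF _ D, where \<delta> = "\<lambda>_. 0" and dec = "\<lambda>_ _ _. 1"
      and P = "\<lambda>n i. if i < nat \<lfloor>u * real n\<rfloor> then P0 else P1"])
  show "(\<lambda>n. 1 / real n * (\<Sum>i<n. sensing PS W (if i < nat \<lfloor>u * real n\<rfloor> then P0 else P1)))
      \<longlonglongrightarrow> u * sensing PS W P0 + (1 - u) * sensing PS W P1"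
    by (rule time_sharing_average[OF u])
qed (auto simp: messages_def)

lemma achievable_below_rate:
  assumes u: "0 \<le> u" "u \<le> 1" and D: "0 \<le> D" "D \<le> u * sensing PS W P0 + (1 - u) * sensing PS W P1"
    and R: "0 \<le> R" "R < u * rate PS W P0 + (1 - u) * rate PS W P1"
  shows "(R, D) \<in> achievable_pairs PS W"
proof -
  define K where "K = Wc PS W"
  define P where "P n i = (if i < nat \<lfloor>u * real n\<rfloor> then P0 else P1)" for n i :: nat
  define R' where "R' = u * rate PS W P0 + (1 - u) * rate PS W P1"
  \<comment> \<open>The gap is split into thirds: one for the Hoeffding deviation, one for the error
    of S n / n against its limit, and one left as the exponent of the confusion term.\<close>
  define \<gamma> where "\<gamma> = (R' - R) / 3"
  have \<gamma>: "\<gamma> > 0" using R by (simp add: \<gamma>_def R'_def)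
  define S where "S n = (\<Sum>i<n. chan_info (P n i) K)" for n
  have S: "(\<lambda>n. 1 / real n * S n) \<longlonglongrightarrow> R'"
    unfolding S_def P_def R'_def rate_eq K_def by (rule time_sharing_average[OF u])
  \<comment> \<open>One bound for all positions, since only two laws occur; the leading 1 makes it
    positive.\<close>
  define B where "B = 1 + (\<Sum>x\<in>UNIV. \<Sum>y\<in>UNIV. \<bar>info_density P0 K x y\<bar> + \<bar>info_density P1 K x y\<bar>)"
  have B: "\<bar>info_density (P n i) K x y\<bar> \<le> B" for n i x y
  proof -
    have "\<bar>info_density (P n i) K x y\<bar> \<le> \<bar>info_density P0 K x y\<bar> + \<bar>info_density P1 K x y\<bar>" by (simp add: P_def)
    also have "\<dots> \<le> (\<Sum>y\<in>UNIV. \<bar>info_density P0 K x y\<bar> + \<bar>info_density P1 K x y\<bar>)"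
      by (rule member_le_sum[of y UNIV "\<lambda>y. \<bar>info_density P0 K x y\<bar> + \<bar>info_density P1 K x y\<bar>"]) auto
    also have "\<dots> \<le> (\<Sum>x\<in>UNIV. \<Sum>y\<in>UNIV. \<bar>info_density P0 K x y\<bar> + \<bar>info_density P1 K x y\<bar>)"
      by (rule member_le_sum[of x UNIV "\<lambda>x. \<Sum>y\<in>UNIV. \<bar>info_density P0 K x y\<bar> + \<bar>info_density P1 K x y\<bar>"])
         (auto intro: sum_nonneg)
    finally show ?thesis by (simp add: B_def)
  qed
  have Bpos: "B > 0" unfolding B_def by (intro add_pos_nonneg sum_nonneg) auto
  \<comment> \<open>The value 1 at n = 0 is the trivial bound on an error probability; the coding
    lemma speaks of positive block lengths.\<close>
  define \<delta> where "\<delta> n = (if n = 0 then 1 else exp (- (real n * \<gamma>\<^sup>2 / (2 * B\<^sup>2))) + card (messages R n) / 2 powr (S n - real n * \<gamma>))" for n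
  define err where "err n G = measure_pmf.expectation (Pi_pmf (messages R n) undefined (\<lambda>_. word_law n (P n)))
     (\<lambda>c. (\<Sum>w\<in>messages R n. measure_pmf.prob (word_law n (\<lambda>i. K (c w i))) {y. decode (messages R n) G c y \<noteq> w}) /
       card (messages R n))" for n G
  have "\<exists>G. n > 0 \<longrightarrow> err n G \<le> \<delta> n" for n
  proof (cases "n > 0")
    case True
    obtain G where "err n G \<le> exp (- (real n * \<gamma>\<^sup>2 / (2 * B\<^sup>2))) + card (messages R n) / 2 powr (S n - real n * \<gamma>)"
      unfolding S_def err_def
      by (rule word_random_coding[OF B Bpos True less_imp_le[OF \<gamma>] messages_finite messages_nonempty[OF R(1)]])
    then show ?thesis using True by (intro exI[of _ G]) (simp add: \<delta>_def)
  qed auto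
  then obtain G where G: "\<And>n. n > 0 \<Longrightarrow> err n (G n) \<le> \<delta> n" by metis
  have \<delta>0: "\<delta> n \<ge> 0" for n by (simp add: \<delta>_def)
  have "\<delta> \<longlonglongrightarrow> 0"
  proof (rule tendsto_sandwich[OF _ _ tendsto_const])
    show "\<forall>\<^sub>F n in sequentially. 0 \<le> \<delta> n" by (simp add: \<delta>0)
    have "\<forall>\<^sub>F n in sequentially. R' - \<gamma> < 1 / real n * S n"
      using order_tendstoD(1)[OF S, of "R' - \<gamma>"] \<gamma> by linarith
    then show "\<forall>\<^sub>F n in sequentially. \<delta> n \<le> exp (- (real n * \<gamma>\<^sup>2 / (2 * B\<^sup>2))) + 2 powr (- \<gamma> * real n)"
      using eventually_gt_at_top[of 0]
    proof eventually_elim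
      case (elim n)
      then have Sn: "S n > real n * (R' - \<gamma>)" by (simp add: less_divide_eq mult.commute)
      have "real (card (messages R n)) \<le> 2 powr (real n * R)"
        unfolding card_messages by (simp add: of_nat_nat)
      then have "card (messages R n) / 2 powr (S n - real n * \<gamma>) \<le> 2 powr (real n * R) / 2 powr (S n - real n * \<gamma>)"
        by (intro divide_right_mono) auto
      also have "\<dots> = 2 powr (real n * R - (S n - real n * \<gamma>))" by (simp add: powr_diff)
      also have "\<dots> \<le> 2 powr (- \<gamma> * real n)"
      proof (intro powr_mono)
        have "3 * \<gamma> = R' - R" by (simp add: \<gamma>_def)
        then have "R' = R + 3 * \<gamma>" by linarith
        then have "real n * R = real n * R' - 3 * (\<gamma> * real n)" by (simp add: algebra_simps)
        then show "real n * R - (S n - real n * \<gamma>) \<le> - \<gamma> * real n" using Sn by (simp add: algebra_simps)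
      qed simp
      finally show ?case using elim by (simp add: \<delta>_def)
    qed
    have exp0: "(\<lambda>n. exp (- (real n * c))) \<longlonglongrightarrow> 0" if "c > 0" for c :: real
      using that by real_asymp
    have "\<gamma>\<^sup>2 / (2 * B\<^sup>2) > 0" using \<gamma> Bpos by simp
    from exp0[OF this] have "(\<lambda>n. exp (- (real n * \<gamma>\<^sup>2 / (2 * B\<^sup>2)))) \<longlonglongrightarrow> 0" by simp
    moreover have "(\<lambda>n. 2 powr (- \<gamma> * real n)) \<longlonglongrightarrow> 0" using \<gamma> by real_asymp
    ultimately show "(\<lambda>n. exp (- (real n * \<gamma>\<^sup>2 / (2 * B\<^sup>2))) + 2 powr (- \<gamma> * real n)) \<longlonglongrightarrow> 0"
      using tendsto_add by fastforce
  qed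
  show ?thesis
  proof (rule achievable_if_expected_error[OF R(1) D, where P = P and \<delta> = \<delta> and dec = "\<lambda>n. decode (messages R n) (G n)"])
    show "decode (messages R n) (G n) c y \<in> messages R n" for n c y
      by (rule decode_in[OF messages_finite messages_nonempty[OF R(1)]])
    show "measure_pmf.expectation (Pi_pmf (messages R n) undefined (\<lambda>_. word_law n (P n)))
     (\<lambda>c. (\<Sum>w\<in>messages R n. measure_pmf.prob (word_law n (\<lambda>i. Wc PS W (c w i))) {y. decode (messages R n) (G n) c y \<noteq> w}) / card (messages R n))
     \<le> \<delta> n" for n
    proof (cases "n = 0")
      case True
      have le: "(\<Sum>w\<in>messages R n. measure_pmf.prob (word_law n (\<lambda>i. Wc PS W (c w i))) {y. decode (messages R n) (G n) c y \<noteq> w}) / card (messages R n) \<le> 1" for c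
      proof -
        have "(\<Sum>w\<in>messages R n. measure_pmf.prob (word_law n (\<lambda>i. Wc PS W (c w i))) {y. decode (messages R n) (G n) c y \<noteq> w}) \<le> (\<Sum>w\<in>messages R n. 1)"
          by (intro sum_mono) auto
        then show ?thesis by (simp add: divide_le_eq_1) linarith
      qed
      have "measure_pmf.expectation (Pi_pmf (messages R n) undefined (\<lambda>_. word_law n (P n)))
       (\<lambda>c. (\<Sum>w\<in>messages R n. measure_pmf.prob (word_law n (\<lambda>i. Wc PS W (c w i))) {y. decode (messages R n) (G n) c y \<noteq> w}) / card (messages R n)) \<le> 1"
        by (intro measure_pmf.integral_le_const measure_pmf.integrable_const_bound[where B = 1])
           (auto simp: le sum_nonneg)
      then show ?thesis using True by (simp add: \<delta>_def)
    next
      case False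
      then show ?thesis using G[of n] by (simp add: err_def K_def)
    qed
    show "(\<lambda>n. 1 / real n * (\<Sum>i<n. sensing PS W (P n i))) \<longlonglongrightarrow> u * sensing PS W P0 + (1 - u) * sensing PS W P1"
      unfolding P_def by (rule time_sharing_average[OF u])
  qed (use \<delta>0 \<open>\<delta> \<longlonglongrightarrow> 0\<close> in auto)
qed

end

section \<open>The region\<close>

context
  fixes PS :: "'s::finite pmf" and W :: "'x::finite \<Rightarrow> 's \<Rightarrow> ('y::finite \<times> 'v::finite) pmf"
begin

lemma planar_frontier_single_mode: "planar_frontier (single_mode_points PS W)"
proof
  show "single_mode_points PS W \<noteq> {}" by (simp add: single_mode_points_def)
qed (rule compact_single_mode_points convex_snd_single_mode_points nonneg_single_mode_points)+

interpretation single_mode: planar_frontier "single_mode_points PS W"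
  by (rule planar_frontier_single_mode)

lemma C_cases:
  assumes "(R, D) \<in> single_mode.C"
  obtains P0 P1 u where "0 \<le> R" "0 \<le> D" "0 \<le> u" "u \<le> 1"
    "R \<le> u * rate PS W P0 + (1 - u) * rate PS W P1"
    "D \<le> u * sensing PS W P0 + (1 - u) * sensing PS W P1"
proof -
  obtain R' D' where RD: "0 \<le> R" "0 \<le> D" "(R', D') \<in> single_mode.H" "R \<le> R'" "D \<le> D'"
    using assms by (auto simp: single_mode.C_def in_downward_closure)
  obtain a b u where ab: "a \<in> single_mode_points PS W" "b \<in> single_mode_points PS W" "0 \<le> u" "u \<le> 1"
    "fst (R', D') \<le> u * fst a + (1 - u) * fst b" "snd (R', D') \<le> u * snd a + (1 - u) * snd b"
    by (rule convex_hull_dominated_by_two[OF RD(3)[unfolded single_mode.H_def]]) blast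
  obtain P0 P1 where "a = (rate PS W P0, sensing PS W P0)" "b = (rate PS W P1, sensing PS W P1)"
    using ab by (auto simp: single_mode_points_def)
  then show thesis using RD ab by (intro that[of u P0 P1]) auto
qed

text \<open>Averaging mode points over q stays in the hull. Conversely a point of C is dominated by
  a mixture of two modes, and a Bernoulli variable renamed to {0, 1} realises that mixture.\<close>

lemma region_eq: "region PS W = single_mode.C"
proof (intro equalityI subrelI)
  fix R D assume "(R, D) \<in> region PS W"
  then obtain Q PQ and PXQ :: "nat \<Rightarrow> 'x pmf" where Q: "finite Q" "set_pmf PQ \<subseteq> Q"
    and RD: "0 \<le> R" "R \<le> cond_rate PS W PQ PXQ" "0 \<le> D" "D \<le> cond_sensing PS W PQ PXQ"
    unfolding region_def by auto
  have "(\<Sum>q\<in>Q. pmf PQ q *\<^sub>R (rate PS W (PXQ q), sensing PS W (PXQ q))) \<in> single_mode.H"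
    using Q single_mode.A_H
    by (intro convex_sum single_mode.convex_H sum_pmf_eq_1) (auto simp: single_mode_points_def)
  then have "(cond_rate PS W PQ PXQ, cond_sensing PS W PQ PXQ) \<in> single_mode.H"
    by (simp add: cond_rate_eq[OF Q] cond_sensing_eq[OF Q] sum_prod)
  then show "(R, D) \<in> single_mode.C" using RD by (auto simp: single_mode.C_def in_downward_closure)
next
  fix R D assume "(R, D) \<in> single_mode.C"
  then obtain P0 P1 u where *: "0 \<le> R" "0 \<le> D" "0 \<le> u" "u \<le> 1"
    "R \<le> u * rate PS W P0 + (1 - u) * rate PS W P1"
    "D \<le> u * sensing PS W P0 + (1 - u) * sensing PS W P1"
    by (rule C_cases)
  define i where "i b = (if b then 0 else 1 :: nat)" for b
  define PQ where "PQ = map_pmf i (bernoulli_pmf u)"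
  define PXQ where "PXQ q = (if q = 0 then P0 else P1)" for q :: nat
  have inj: "inj i" by (auto simp: inj_on_def i_def split: if_splits)
  have PQ: "pmf PQ 0 = u" "pmf PQ 1 = 1 - u"
    using pmf_map_inj'[OF inj, of "bernoulli_pmf u" True] pmf_map_inj'[OF inj, of "bernoulli_pmf u" False] *
    by (simp_all add: PQ_def i_def)
  have Q: "finite {0, 1::nat}" "set_pmf PQ \<subseteq> {0, 1}" by (auto simp: PQ_def i_def)
  have "cond_rate PS W PQ PXQ = u * rate PS W P0 + (1 - u) * rate PS W P1"
    "cond_sensing PS W PQ PXQ = u * sensing PS W P0 + (1 - u) * sensing PS W P1"
    unfolding cond_rate_eq[OF Q] cond_sensing_eq[OF Q] using PQ by (simp_all add: PXQ_def)
  then have "(R, D) \<in> {0..cond_rate PS W PQ PXQ} \<times> {0..cond_sensing PS W PQ PXQ}" using * by auto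
  moreover have "card {0, 1::nat} \<le> 2" by simp
  ultimately show "(R, D) \<in> region PS W" unfolding region_def using Q by blast
qed

text \<open>Rounding a number that is at least 1 down to an integer at most halves it, which costs
  at most one bit.\<close>

lemma log_card_messages:
  assumes "R \<ge> 0"
  shows "log 2 (card (messages R n)) \<ge> real n * R - 1"
proof -
  have "2 powr (real n * R) \<ge> 1" using assms by (simp add: ge_one_powr_ge_zero)
  then have "\<lfloor>2 powr (real n * R)\<rfloor> \<ge> 1" by (simp add: le_floor_iff)
  then have "real (card (messages R n)) = of_int \<lfloor>2 powr (real n * R)\<rfloor>" "real (card (messages R n)) \<ge> 1"
    unfolding card_messages by simp_all
  then have "2 powr (real n * R) / 2 \<le> real (card (messages R n))"
    using real_of_int_floor_gt_diff_one[of "2 powr (real n * R)"] by linarith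
  then have "log 2 (2 powr (real n * R) / 2) \<le> log 2 (card (messages R n))" by (intro log_mono) auto
  then show ?thesis by (simp add: log_divide)
qed

text \<open>The uniformly weighted positions are the modes of a point of H. Of the loss 2 / n, one
  part comes from the converse and one from rounding the number of messages.\<close>

lemma code_point_bound:
  assumes R: "R \<ge> 0" and n: "n > 0"
  obtains r where "(r, code_sensing PS W R n f) \<in> single_mode.H"
    "R * (1 - error_prob PS W R n f \<phi>) - 2 / real n \<le> r"
proof -
  let ?P = "input_marginal R n f" and ?e = "error_prob PS W R n f \<phi>"
  define r where "r = 1 / real n * (\<Sum>i<n. rate PS W (?P i))"
  have "(\<Sum>i<n. (1 / real n) *\<^sub>R (rate PS W (?P i), sensing PS W (?P i))) \<in> single_mode.H"
    using n single_mode.A_H by (intro convex_sum single_mode.convex_H) (auto simp: single_mode_points_def)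
  then have H: "(r, code_sensing PS W R n f) \<in> single_mode.H"
    by (simp add: r_def code_sensing_def sum_prod sum_divide_distrib)
  have e: "0 \<le> ?e" "?e \<le> 1" unfolding error_prob_def by auto
  have "(1 - ?e) * log 2 (card (messages R n)) - 1 \<le> (\<Sum>i<n. rate PS W (?P i))"
    unfolding error_prob_eq[OF R] rate_eq input_marginal_def
    by (rule code_converse[OF messages_finite messages_nonempty[OF R]])
  moreover have "(1 - ?e) * (real n * R - 1) \<le> (1 - ?e) * log 2 (card (messages R n))"
    using e by (intro mult_left_mono log_card_messages R) auto
  moreover have "(1 - ?e) * (real n * R - 1) \<ge> real n * (R * (1 - ?e)) - 1"
    using e by (simp add: algebra_simps)
  ultimately have "real n * (R * (1 - ?e)) - 2 \<le> (\<Sum>i<n. rate PS W (?P i))" by linarith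
  then have "(real n * (R * (1 - ?e)) - 2) / real n \<le> r"
    unfolding r_def using n by (simp add: divide_right_mono)
  then have "R * (1 - ?e) - 2 / real n \<le> r" using n by (simp add: diff_divide_distrib)
  with H show thesis by (rule that)
qed

lemma closed_C: "closed single_mode.C"
  unfolding single_mode.C_def by (rule closed_downward_closure[OF single_mode.compact_H])

lemma achievable_subset_C: "achievable_pairs PS W \<subseteq> single_mode.C"
proof (rule subrelI)
  fix R D assume "(R, D) \<in> achievable_pairs PS W"
  then obtain f \<phi> where RD: "0 \<le> R" "0 \<le> D"
    and err: "(\<lambda>n. error_prob PS W R n (f n) (\<phi> n)) \<longlonglongrightarrow> 0"
    and sens: "ereal D \<le> liminf (\<lambda>n. ereal (code_sensing PS W R n (f n)))"
    unfolding achievable_pairs_def by auto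
  \<comment> \<open>Truncation at 0 keeps the approximating point in the quadrant that contains C;
    closedness then removes \<epsilon>.\<close>
  have approx: "(max 0 (R - \<epsilon>), max 0 (D - \<epsilon>)) \<in> single_mode.C" if "\<epsilon> > 0" for \<epsilon>
  proof -
    have "(\<lambda>n. R * (1 - error_prob PS W R n (f n) (\<phi> n)) - 2 * (1 / real n)) \<longlonglongrightarrow> R * (1 - 0) - 2 * 0"
      by (intro tendsto_intros err lim_1_over_n)
    then have 1: "\<forall>\<^sub>F n in sequentially. R - \<epsilon> < R * (1 - error_prob PS W R n (f n) (\<phi> n)) - 2 * (1 / real n)"
      using order_tendstoD(1)[of _ "R * (1 - 0) - 2 * 0" sequentially "R - \<epsilon>"] that by simp
    have "ereal (D - \<epsilon>) < ereal D" using that by simp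
    then have "ereal (D - \<epsilon>) < liminf (\<lambda>n. ereal (code_sensing PS W R n (f n)))" using sens by (rule less_le_trans)
    then have 2: "\<forall>\<^sub>F n in sequentially. ereal (D - \<epsilon>) < ereal (code_sensing PS W R n (f n))"
      by (rule less_LiminfD)
    have "\<forall>\<^sub>F n in sequentially. R - \<epsilon> < R * (1 - error_prob PS W R n (f n) (\<phi> n)) - 2 * (1 / real n) \<and>
        D - \<epsilon> < code_sensing PS W R n (f n) \<and> n > 0"
      using 1 2 eventually_gt_at_top[of 0] by eventually_elim auto
    then obtain n where n: "R - \<epsilon> < R * (1 - error_prob PS W R n (f n) (\<phi> n)) - 2 * (1 / real n)"
        "D - \<epsilon> < code_sensing PS W R n (f n)" "n > 0"
      using eventually_happens'[OF sequentially_bot] by blast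
    obtain r where r: "(r, code_sensing PS W R n (f n)) \<in> single_mode.H"
      "R * (1 - error_prob PS W R n (f n) (\<phi> n)) - 2 / real n \<le> r"
      by (rule code_point_bound[OF RD(1) n(3), of "f n" "\<phi> n"]) blast
    have "0 \<le> r" "0 \<le> code_sensing PS W R n (f n)" using r(1) single_mode.nonneg_H by auto
    then show ?thesis using r n unfolding single_mode.C_def in_downward_closure by auto
  qed
  have "(\<lambda>k. (max 0 (R - 1 / real (Suc k)), max 0 (D - 1 / real (Suc k)))) \<longlonglongrightarrow> (max 0 (R - 0), max 0 (D - 0))"
    by (intro tendsto_Pair tendsto_max tendsto_diff tendsto_const LIMSEQ_Suc[OF lim_1_over_n])
  then have "(max 0 (R - 0), max 0 (D - 0)) \<in> single_mode.C"
    by (rule closed_sequentially[OF closed_C, rotated]) (auto intro: approx)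
  then show "(R, D) \<in> single_mode.C" using RD by simp
qed

text \<open>The rate is approached from strictly below by scaling, with the sensing level held
  fixed; at R = 0 scaling gives nothing smaller, and codes with one message take over.\<close>

lemma C_subset_closure: "single_mode.C \<subseteq> closure (achievable_pairs PS W)"
proof (rule subrelI)
  fix R D assume "(R, D) \<in> single_mode.C"
  then obtain P0 P1 u where *: "0 \<le> R" "0 \<le> D" "0 \<le> u" "u \<le> 1"
    "R \<le> u * rate PS W P0 + (1 - u) * rate PS W P1"
    "D \<le> u * sensing PS W P0 + (1 - u) * sensing PS W P1"
    by (rule C_cases)
  show "(R, D) \<in> closure (achievable_pairs PS W)"
  proof (cases "R = 0")
    case True
    then show ?thesis using achievable_rate_zero[OF *(3,4,2,6)] closure_subset by blast
  next
    case False
    define Rk where "Rk k = R * (1 - 1 / real (Suc k))" for k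
    have "(Rk k, D) \<in> achievable_pairs PS W" for k
    proof (rule achievable_below_rate[OF *(3,4,2,6)])
      show "0 \<le> Rk k" using *(1) by (auto simp: Rk_def intro!: mult_nonneg_nonneg)
      have "Rk k < R" using False *(1) by (simp add: Rk_def)
      then show "Rk k < u * rate PS W P0 + (1 - u) * rate PS W P1" using *(5) by linarith
    qed
    moreover have "(\<lambda>k. (Rk k, D)) \<longlonglongrightarrow> (R * (1 - 0), D)"
      unfolding Rk_def by (intro tendsto_Pair tendsto_mult tendsto_diff tendsto_const LIMSEQ_Suc[OF lim_1_over_n])
    ultimately show ?thesis unfolding closure_sequential by (intro exI[of _ "\<lambda>k. (Rk k, D)"]) simp
  qed
qed

lemma closure_achievable: "closure (achievable_pairs PS W) = region PS W"
  unfolding region_eq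
  by (intro equalityI closure_minimal achievable_subset_C closed_C C_subset_closure)

lemma region_frontier:
  fixes C A T
  defines "C \<equiv> region PS W" and "A \<equiv> single_mode_points PS W" and "T \<equiv> tradeoff_boundary (region PS W)"
  shows "rate_endpoint T \<in> T" "sensing_endpoint T \<in> T"
    "{snd (rate_endpoint T)..snd (sensing_endpoint T)} \<subseteq> snd ` A"
    "\<exists>g. is_upper_concave_envelope (snd ` A) (upper_boundary A) g \<and>
       T = (\<lambda>d. (g d, d)) ` {snd (rate_endpoint T)..snd (sensing_endpoint T)}"
    "C = downward_closure T"
    "outer_boundary C = T \<union> rate_extension T \<union> sensing_extension T"
    "snd (rate_endpoint T) \<noteq> 0 \<Longrightarrow> {rate_endpoint T} \<subset> rate_extension T"
    "rate_extension T \<inter> T = {rate_endpoint T}"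
    "fst (sensing_endpoint T) \<noteq> 0 \<Longrightarrow> {sensing_endpoint T} \<subset> sensing_extension T"
    "sensing_extension T \<inter> T = {sensing_endpoint T}"
proof -
  have C: "C = single_mode.C" and T: "T = single_mode.T"
    unfolding C_def T_def region_eq single_mode.T_def by (rule refl)+
  note defs = C T A_def
  show "rate_endpoint T \<in> T" "sensing_endpoint T \<in> T"
    "snd (rate_endpoint T) \<noteq> 0 \<Longrightarrow> {rate_endpoint T} \<subset> rate_extension T"
    "rate_extension T \<inter> T = {rate_endpoint T}"
    "fst (sensing_endpoint T) \<noteq> 0 \<Longrightarrow> {sensing_endpoint T} \<subset> sensing_extension T"
    "sensing_extension T \<inter> T = {sensing_endpoint T}"
    unfolding defs by (fact single_mode.endpoint_extensions)+
  show "{snd (rate_endpoint T)..snd (sensing_endpoint T)} \<subseteq> snd ` A"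
    unfolding defs by (rule single_mode.T_graph(1))
  show "\<exists>g. is_upper_concave_envelope (snd ` A) (upper_boundary A) g \<and>
       T = (\<lambda>d. (g d, d)) ` {snd (rate_endpoint T)..snd (sensing_endpoint T)}"
    unfolding defs using single_mode.env_envelope single_mode.T_graph(2) by blast
  show "C = downward_closure T" unfolding defs by (rule single_mode.C_eq)
  show "outer_boundary C = T \<union> rate_extension T \<union> sensing_extension T"
    unfolding defs by (rule single_mode.outer_boundary_eq)
qed

end

text \<open>W occurs in the region only through \<open>Wc\<close> and \<open>Ws\<close>. The closure
  of the achievable pairs inherits this through its equality with the region, so codes are never
  compared across two channels.\<close>

lemma region_cong:
  assumes "Wc PS W' = Wc PS W" "Ws W' = Ws W"
  shows "region PS W' = region PS W"
  using assms unfolding region_def cond_rate_def cond_sensing_def by simp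

theorem theorem1:
  fixes PS :: "'s::finite pmf"
    and W :: "'x::finite \<Rightarrow> 's \<Rightarrow> ('y::finite \<times> 'v::finite) pmf"
  shows
    "let C = region PS W;
         A = single_mode_points PS W;
         T = tradeoff_boundary C
     in closure (achievable_pairs PS W) = C \<and>
        (\<forall>W' :: 'x \<Rightarrow> 's \<Rightarrow> ('y \<times> 'v) pmf.
           Wc PS W' = Wc PS W \<and> Ws W' = Ws W \<longrightarrow>
           region PS W' = C \<and> closure (achievable_pairs PS W') = C) \<and>
        rate_endpoint T \<in> T \<and> sensing_endpoint T \<in> T \<and>
        {snd (rate_endpoint T)..snd (sensing_endpoint T)} \<subseteq> snd ` A \<and>
        (\<exists>g. is_upper_concave_envelope (snd ` A) (upper_boundary A) g \<and>
           T = (\<lambda>d. (g d, d)) ` {snd (rate_endpoint T)..snd (sensing_endpoint T)}) \<and>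
        C = downward_closure T \<and>
        outer_boundary C = T \<union> rate_extension T \<union> sensing_extension T \<and>
        (snd (rate_endpoint T) \<noteq> 0 \<longrightarrow>
           {rate_endpoint T} \<subset> rate_extension T \<and>
           rate_extension T \<inter> T = {rate_endpoint T}) \<and>
        (fst (sensing_endpoint T) \<noteq> 0 \<longrightarrow>
           {sensing_endpoint T} \<subset> sensing_extension T \<and>
           sensing_extension T \<inter> T = {sensing_endpoint T})"
proof -
  have inv: "region PS W' = region PS W" "closure (achievable_pairs PS W') = region PS W"
    if "Wc PS W' = Wc PS W \<and> Ws W' = Ws W" for W' :: "'x \<Rightarrow> 's \<Rightarrow> ('y \<times> 'v) pmf"
    unfolding closure_achievable using region_cong[of PS W' W] that by blast+
  show ?thesis
    unfolding Let_def by (intro conjI allI impI region_frontier closure_achievable inv) auto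
qed

end
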